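(* Let $n\ge2$, $N:=\{1,\ldots,n\}$, let $\overline Y\subseteq\bigwedge^2\mathbb K^{n+1}$ be the affine cone over the Grassmannian $\mathrm{Gr}(2,n+1)$, and let $H=(\mathbb K^* )^n$ act on $\overline Y$ by $h\cdot e_0\wedge e_j=h_j\,e_0\wedge e_j$ and $h\cdot e_i\wedge e_j=h_ih_j\,e_i\wedge e_j$ ($1\le i<j\le n$). Set $\Omega:=\mathbb Q^n_{\ge0}$. Then the GIT-fan $\Lambda_H(\overline Y)$ is the fan supported on $\Omega$ with walls given by the intersections $\mathcal H_R\cap\Omega$, where $R$ runs through the two-block partitions of $N$ (i.e. it is the fan obtained by subdividing $\Omega$ along the hyperplanes $\mathcal H_R$).
   Context: $\mathbb K$ is an algebraically closed field; $e_0,\ldots,e_n$ is the standard basis of $\mathbb K^{n+1}$. A two-block partition of $N$ is a partition $R=\{A,A^c\}$ of $N$ into two disjoint nonempty subsets; to it one associates the hyperplane $\mathcal H_R:=\{x\in\mathbb Q^n;\ \sum_{i\in A}x_i=\sum_{i\in A^c}x_i\}$. GIT-fan: Let the coordinates of $\bigwedge^2\mathbb K^{n+1}$ be indexed by $\mathbf N_0:=\{\{i,j\};\ 0\le i<j\le n\}$, where $\{i,j\}$ corresponds to $e_i\wedge e_j$. The weights of the $H$-action are $w_{0i}=e_i$, $w_{jk}=e_j+e_k\in\mathbb Z^n$ ($1\le i\le n$, $1\le j<k\le n$). A subset $I\subseteq\mathbf N_0$ is a $\overline Y$-set if $\{z\in\overline Y;\ z_\eta\neq0\Leftrightarrow\eta\in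 I\}$ is non-empty. Put $\omega_I:=\mathrm{cone}(w_\eta;\ \eta\in I)\subseteq\mathbb Q^n$. The GIT-fan is $\Lambda_H(\overline Y):=\{\lambda(w);\ w\in\Omega\}$, where $\lambda(w):=\bigcap\omega_I$, the intersection being over all $\overline Y$-sets $I$ with $w\in\omega_I$. *)

theory Defs
  imports "HOL-Library.FuncSet" "HOL-Library.Disjoint_Sets" "HOL-Computational_Algebra.Polynomial"
begin

text \<open>
  Coordinate vectors are functions vanishing outside their index set:
  \<open>\<rat>\<^sup>n\<close> is \<open>coord_space {1..n}\<close>, \<open>K\<^bsup>n+1\<^esup>\<close> is \<open>coord_space {0..n}\<close>, and the second exterior power
  of \<open>K\<^bsup>n+1\<^esup>\<close> is \<open>coord_space (pairs n)\<close>.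
\<close>

definition coord_space :: "'i set \<Rightarrow> ('i \<Rightarrow> 'a::zero) set" where
  "coord_space I = {x. \<forall>i. i \<notin> I \<longrightarrow> x i = 0}"

definition unit_vec :: "'i \<Rightarrow> 'i \<Rightarrow> 'a::zero_neq_one" where
  "unit_vec i = (\<lambda>j. if j = i then 1 else 0)"


section \<open>Rational cones and fans\<close>

definition dot :: "nat \<Rightarrow> (nat \<Rightarrow> rat) \<Rightarrow> (nat \<Rightarrow> rat) \<Rightarrow> rat" where
  "dot n u x = (\<Sum>i\<in>{1..n}. u i * x i)"

definition cone_of :: "('e \<Rightarrow> nat \<Rightarrow> rat) \<Rightarrow> 'e set \<Rightarrow> (nat \<Rightarrow> rat) set" where
  "cone_of w I = {x. \<exists>a. (\<forall>\<eta>\<in>I. 0 \<le> a \<eta>) \<and> x = (\<lambda>i. \<Sum>\<eta>\<in>I. a \<eta> * w \<eta> i)}"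

definition polyhedral_cone :: "nat \<Rightarrow> (nat \<Rightarrow> rat) set \<Rightarrow> bool" where
  "polyhedral_cone n \<sigma> \<longleftrightarrow> (\<exists>U. finite U \<and> U \<subseteq> coord_space {1..n} \<and>
     \<sigma> = {x \<in> coord_space {1..n}. \<forall>u\<in>U. 0 \<le> dot n u x})"

definition pointed_cone :: "(nat \<Rightarrow> rat) set \<Rightarrow> bool" where
  "pointed_cone \<sigma> \<longleftrightarrow> (\<forall>x\<in>\<sigma>. (\<lambda>i. - x i) \<in> \<sigma> \<longrightarrow> x = (\<lambda>i. 0))"

definition face_of_cone :: "nat \<Rightarrow> (nat \<Rightarrow> rat) set \<Rightarrow> (nat \<Rightarrow> rat) set \<Rightarrow> bool" where
  "face_of_cone n \<tau> \<sigma> \<longleftrightarrow> (\<exists>u\<in>coord_space {1..n}. (\<forall>x\<in>\<sigma>. 0 \<le> dot n u x) \<and>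
     \<tau> = {x \<in> \<sigma>. dot n u x = 0})"

definition is_fan :: "nat \<Rightarrow> (nat \<Rightarrow> rat) set set \<Rightarrow> bool" where
  "is_fan n \<Sigma> \<longleftrightarrow> finite \<Sigma> \<and>
     (\<forall>\<sigma>\<in>\<Sigma>. polyhedral_cone n \<sigma> \<and> pointed_cone \<sigma>) \<and>
     (\<forall>\<sigma>\<in>\<Sigma>. \<forall>\<tau>. face_of_cone n \<tau> \<sigma> \<longrightarrow> \<tau> \<in> \<Sigma>) \<and>
     (\<forall>\<sigma>\<in>\<Sigma>. \<forall>\<sigma>'\<in>\<Sigma>. face_of_cone n (\<sigma> \<inter> \<sigma>') \<sigma> \<and> face_of_cone n (\<sigma> \<inter> \<sigma>') \<sigma>')"

definition orthant :: "nat \<Rightarrow> (nat \<Rightarrow> rat) set" where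
  "orthant n = {x \<in> coord_space {1..n}. \<forall>i\<in>{1..n}. 0 \<le> x i}"

text \<open>
  The three cones (the hyperplane and its two closed half-spaces) into which a linear hyperplane
  divides \<open>\<rat>\<^sup>n\<close>; a normal vector \<open>u\<close> and its negative yield the two half-spaces.
\<close>

definition hyperplane_sides :: "nat \<Rightarrow> (nat \<Rightarrow> rat) set \<Rightarrow> (nat \<Rightarrow> rat) set set" where
  "hyperplane_sides n H = {\<sigma>. \<exists>u\<in>coord_space {1..n} - {\<lambda>i. 0}.
     H = {x \<in> coord_space {1..n}. dot n u x = 0} \<and>
     (\<sigma> = H \<or> \<sigma> = {x \<in> coord_space {1..n}. 0 \<le> dot n u x})}"

text \<open>
  Subdividing a cone along hyperplanes: the common refinement of the fan of faces of the cone with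
  the subdivisions of \<open>\<rat>\<^sup>n\<close> given by the individual hyperplanes. The cells include all faces of the
  full-dimensional chambers.
\<close>

definition subdivision :: "nat \<Rightarrow> (nat \<Rightarrow> rat) set \<Rightarrow> (nat \<Rightarrow> rat) set set \<Rightarrow> (nat \<Rightarrow> rat) set set" where
  "subdivision n \<sigma> \<H> = {\<tau> \<inter> (\<Inter>H\<in>\<H>. s H) |\<tau> s.
     face_of_cone n \<tau> \<sigma> \<and> (\<forall>H\<in>\<H>. s H \<in> hyperplane_sides n H)}"

definition two_block_partitions :: "nat \<Rightarrow> nat set set set" where
  "two_block_partitions n = {R. partition_on {1..n} R \<and> card R = 2}"

definition partition_hyperplane :: "nat \<Rightarrow> nat set set \<Rightarrow> (nat \<Rightarrow> rat) set" where
  "partition_hyperplane n R = {x \<in> coord_space {1..n}. \<forall>A\<in>R. (\<Sum>i\<in>A. x i) = (\<Sum>i\<in>{1..n} - A. x i)}"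


section \<open>The cone over the Grassmannian and the torus action\<close>

definition pairs :: "nat \<Rightarrow> nat set set" where
  "pairs n = {{i, j} |i j. i < j \<and> j \<le> n}"

definition wedge :: "nat \<Rightarrow> (nat \<Rightarrow> 'k::field) \<Rightarrow> (nat \<Rightarrow> 'k) \<Rightarrow> (nat set \<Rightarrow> 'k)" where
  "wedge n u v = (\<lambda>\<eta>. if \<eta> \<in> pairs n then u (Min \<eta>) * v (Max \<eta>) - u (Max \<eta>) * v (Min \<eta>) else 0)"

text \<open>
  The Pluecker embedding sends the plane spanned by \<open>u\<close> and \<open>v\<close> to the line through \<open>u \<and> v\<close>, so the
  affine cone consists of the decomposable bivectors; linearly dependent \<open>u\<close>, \<open>v\<close> give the apex.
\<close>

definition grassmann_cone :: "nat \<Rightarrow> (nat set \<Rightarrow> 'k::field) set" where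
  "grassmann_cone n = {wedge n u v |u v. u \<in> coord_space {0..n} \<and> v \<in> coord_space {0..n}}"

definition torus :: "nat \<Rightarrow> (nat \<Rightarrow> 'k::field) set" where
  "torus n = {1..n} \<rightarrow>\<^sub>E - {0}"

definition torus_act :: "(nat \<Rightarrow> 'k::field) \<Rightarrow> (nat set \<Rightarrow> 'k) \<Rightarrow> (nat set \<Rightarrow> 'k)" where
  "torus_act h z = (\<lambda>\<eta>. (if 0 \<in> \<eta> then h (Max \<eta>) else h (Min \<eta>) * h (Max \<eta>)) * z \<eta>)"

lemma wedge_unit_vec:
  assumes "i < j" "j \<le> n"
  shows "wedge n (unit_vec i) (unit_vec j) = (unit_vec {i, j} :: nat set \<Rightarrow> 'k::field)"
proof
  fix \<eta>
  show "wedge n (unit_vec i) (unit_vec j) \<eta> = (unit_vec {i, j} \<eta> :: 'k)"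
  proof (cases "\<eta> \<in> pairs n")
    case True
    then obtain k l where kl: "\<eta> = {k, l}" "k < l" by (auto simp: pairs_def)
    then have "Min \<eta> = k" "Max \<eta> = l" by auto
    moreover have "\<eta> = {i, j} \<longleftrightarrow> k = i \<and> l = j"
      using kl assms by (metis doubleton_eq_iff less_asym)
    moreover have "\<not> (l = i \<and> k = j)" using kl assms by linarith
    ultimately show ?thesis using True by (auto simp: wedge_def unit_vec_def)
  next
    case False
    moreover have "{i, j} \<in> pairs n" using assms unfolding pairs_def by blast
    ultimately have "\<eta> \<noteq> {i, j}" by blast
    with False show ?thesis by (simp add: wedge_def unit_vec_def)
  qed
qed

lemma torus_act_wedge_0:
  assumes "1 \<le> j" "j \<le> n"
  shows "torus_act h (wedge n (unit_vec 0) (unit_vec j)) =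
    (\<lambda>\<eta>. h j * wedge n (unit_vec 0) (unit_vec j) \<eta> :: 'k::field)"
proof -
  have "0 < j" using assms by simp
  then have "wedge n (unit_vec 0) (unit_vec j) = (unit_vec {0, j} :: nat set \<Rightarrow> 'k)"
    using assms by (intro wedge_unit_vec)
  then show ?thesis by (auto simp: torus_act_def unit_vec_def fun_eq_iff)
qed

lemma torus_act_wedge:
  assumes "1 \<le> i" "i < j" "j \<le> n"
  shows "torus_act h (wedge n (unit_vec i) (unit_vec j)) =
    (\<lambda>\<eta>. h i * h j * wedge n (unit_vec i) (unit_vec j) \<eta> :: 'k::field)"
proof -
  have "wedge n (unit_vec i) (unit_vec j) = (unit_vec {i, j} :: nat set \<Rightarrow> 'k)"
    using assms by (intro wedge_unit_vec)
  then show ?thesis using assms by (auto simp: torus_act_def unit_vec_def fun_eq_iff)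
qed

definition torus_character :: "nat \<Rightarrow> (nat \<Rightarrow> int) \<Rightarrow> (nat \<Rightarrow> 'k::field) \<Rightarrow> 'k" where
  "torus_character n w h = (\<Prod>i\<in>{1..n}. h i powi w i)"

definition is_weight ::
  "nat \<Rightarrow> ((nat \<Rightarrow> 'k::field) \<Rightarrow> (nat set \<Rightarrow> 'k) \<Rightarrow> (nat set \<Rightarrow> 'k)) \<Rightarrow> nat set \<Rightarrow> (nat \<Rightarrow> int) \<Rightarrow> bool"
  where
  "is_weight n act \<eta> w \<longleftrightarrow> w \<in> coord_space {1..n} \<and>
     (\<forall>h\<in>torus n. act h (unit_vec \<eta>) = (\<lambda>\<xi>. torus_character n w h * unit_vec \<eta> \<xi>))"

definition weight ::
  "nat \<Rightarrow> ((nat \<Rightarrow> 'k::field) \<Rightarrow> (nat set \<Rightarrow> 'k) \<Rightarrow> (nat set \<Rightarrow> 'k)) \<Rightarrow> nat set \<Rightarrow> (nat \<Rightarrow> int)"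
  where
  "weight n act \<eta> = (THE w. is_weight n act \<eta> w)"

lemma powi_eq_imp_eq_exponent:
  assumes "\<And>x::'k::alg_closed_field. x \<noteq> 0 \<Longrightarrow> x powi a = x powi b"
  shows "a = b"
proof -
  have less: False
    if lt: "a < b" and eq: "\<And>x::'k. x \<noteq> 0 \<Longrightarrow> x powi a = x powi b" for a b
  proof -
    define m where "m = nat (b - a)"
    have m: "0 < m" "b - a = int m" using lt by (auto simp: m_def)
    have one: "x ^ m = 1" if "x \<noteq> 0" for x :: 'k
    proof -
      have "x powi (b - a) = 1"
        using eq[OF that] that by (subst power_int_diff) auto
      then show ?thesis unfolding m(2) by simp
    qed
    define p :: "'k poly" where "p = monom 1 (Suc m) - monom 1 1 + 1"
    have "coeff p (Suc m) = 1" using m(1) unfolding p_def coeff_add coeff_diff coeff_monom by simp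
    then have "coeff p (Suc m) \<noteq> 0" by (metis zero_neq_one)
    then have "Suc m \<le> degree p" by (rule le_degree)
    then have "degree p > 0" by linarith
    then obtain x where x: "poly p x = 0"
      using alg_closed_imp_poly_has_root[of p] by blast
    have "poly p x = x * x^m - x + 1"
      unfolding p_def poly_add poly_diff poly_monom by simp
    also have "\<dots> = 1"
      by (cases "x = 0") (simp_all add: one)
    finally show False using x by simp
  qed
  show ?thesis
  proof (rule ccontr)
    assume "a \<noteq> b"
    then consider "a < b" | "b < a" by linarith
    then show False
    proof cases
      case 1 then show False by (rule less) (fact assms)
    next
      case 2 then show False by (rule less) (rule assms[symmetric])
    qed
  qed
qed

lemma torus_character_inject:
  assumes "w \<in> coord_space {1..n}" "w' \<in> coord_space {1..n}"
    and eq: "\<And>h::nat \<Rightarrow> 'k::alg_closed_field.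
      h \<in> torus n \<Longrightarrow> torus_character n w h = torus_character n w' h"
  shows "w = w'"
proof
  fix i
  show "w i = w' i"
  proof (cases "i \<in> {1..n}")
    case True
    have "x powi w i = x powi w' i" if "x \<noteq> 0" for x :: 'k
    proof -
      define h where "h = (\<lambda>j\<in>{1..n}. if j = i then x else 1)"
      have "h \<in> torus n" using that by (auto simp: h_def torus_def)
      moreover have "torus_character n v h = x powi v i" for v
      proof -
        have "torus_character n v h = (\<Prod>j\<in>{1..n}. if j = i then x powi v i else 1)"
          unfolding torus_character_def by (rule prod.cong) (auto simp: h_def)
        then show ?thesis using True by simp
      qed
      ultimately show ?thesis using eq[of h] by simp
    qed
    then show ?thesis by (rule powi_eq_imp_eq_exponent)
  next
    case False
    then show ?thesis using assms(1,2) by (simp add: coord_space_def)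
  qed
qed

lemma weight_eqI:
  fixes act :: "(nat \<Rightarrow> 'k::alg_closed_field) \<Rightarrow> (nat set \<Rightarrow> 'k) \<Rightarrow> (nat set \<Rightarrow> 'k)"
  assumes "is_weight n act \<eta> w"
  shows "weight n act \<eta> = w"
  unfolding weight_def
proof (rule the_equality)
  fix w' assume w': "is_weight n act \<eta> w'"
  have "torus_character n w' h = torus_character n w h" if "h \<in> torus n" for h :: "nat \<Rightarrow> 'k"
  proof -
    have "(\<lambda>\<xi>. torus_character n w' h * unit_vec \<eta> \<xi>) = (\<lambda>\<xi>. torus_character n w h * unit_vec \<eta> \<xi>)"
      using assms w' that by (metis is_weight_def)
    from fun_cong[OF this, of \<eta>] show ?thesis by (simp add: unit_vec_def)
  qed
  then show "w' = w"
    using assms w' by (intro torus_character_inject) (auto simp: is_weight_def)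
qed (fact assms)

lemma torus_character_unit_vec:
  assumes "i \<in> {1..n}"
  shows "torus_character n (unit_vec i) h = h i"
proof -
  have "torus_character n (unit_vec i) h = (\<Prod>j\<in>{1..n}. if j = i then h i else 1)"
    unfolding torus_character_def by (rule prod.cong) (auto simp: unit_vec_def)
  then show ?thesis using assms by simp
qed

lemma weight_torus_act_0:
  assumes "1 \<le> i" "i \<le> n"
  shows "weight n (torus_act :: (nat \<Rightarrow> 'k::alg_closed_field) \<Rightarrow> _) {0, i} = unit_vec i"
proof (rule weight_eqI, unfold is_weight_def, intro conjI ballI)
  show "(unit_vec i :: nat \<Rightarrow> int) \<in> coord_space {1..n}"
    using assms by (auto simp: coord_space_def unit_vec_def)
  fix h :: "nat \<Rightarrow> 'k" assume "h \<in> torus n"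
  show "torus_act h (unit_vec {0, i}) =
      (\<lambda>\<xi>. torus_character n (unit_vec i) h * unit_vec {0, i} \<xi>)"
    using torus_act_wedge_0[of i n h] assms by (simp add: wedge_unit_vec torus_character_unit_vec)
qed

lemma weight_torus_act:
  assumes "1 \<le> j" "j < k" "k \<le> n"
  shows "weight n (torus_act :: (nat \<Rightarrow> 'k::alg_closed_field) \<Rightarrow> _) {j, k} =
    (\<lambda>i. unit_vec j i + unit_vec k i)"
proof (rule weight_eqI, unfold is_weight_def, intro conjI ballI)
  show "(\<lambda>i. unit_vec j i + unit_vec k i :: int) \<in> coord_space {1..n}"
    using assms by (auto simp: coord_space_def unit_vec_def)
  fix h :: "nat \<Rightarrow> 'k" assume "h \<in> torus n"
  then have "h i \<noteq> 0" if "i \<in> {1..n}" for i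
    using that by (auto simp: torus_def PiE_iff)
  then have "torus_character n (\<lambda>i. unit_vec j i + unit_vec k i) h =
      torus_character n (unit_vec j) h * torus_character n (unit_vec k) h"
    unfolding torus_character_def prod.distrib[symmetric]
    by (intro prod.cong) (auto simp: power_int_add)
  also have "\<dots> = h j * h k"
    using assms by (simp add: torus_character_unit_vec)
  finally show "torus_act h (unit_vec {j, k}) =
      (\<lambda>\<xi>. torus_character n (\<lambda>i. unit_vec j i + unit_vec k i) h * unit_vec {j, k} \<xi>)"
    using torus_act_wedge[of j k n h] assms by (simp add: wedge_unit_vec)
qed


section \<open>The GIT-fan\<close>

definition orbit_sets :: "nat \<Rightarrow> (nat set \<Rightarrow> 'k::field) set \<Rightarrow> nat set set set" where
  "orbit_sets n Y = {I. I \<subseteq> pairs n \<and> {z \<in> Y. \<forall>\<eta>\<in>pairs n. z \<eta> \<noteq> 0 \<longleftrightarrow> \<eta> \<in> I} \<noteq> {}}"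

definition orbit_cone ::
  "nat \<Rightarrow> ((nat \<Rightarrow> 'k::field) \<Rightarrow> (nat set \<Rightarrow> 'k) \<Rightarrow> (nat set \<Rightarrow> 'k)) \<Rightarrow> nat set set \<Rightarrow> (nat \<Rightarrow> rat) set"
  where
  "orbit_cone n act I = cone_of (\<lambda>\<eta> i. of_int (weight n act \<eta> i)) I"

definition GIT_cone ::
  "nat \<Rightarrow> ((nat \<Rightarrow> 'k::field) \<Rightarrow> (nat set \<Rightarrow> 'k) \<Rightarrow> (nat set \<Rightarrow> 'k)) \<Rightarrow> (nat set \<Rightarrow> 'k) set
     \<Rightarrow> (nat \<Rightarrow> rat) \<Rightarrow> (nat \<Rightarrow> rat) set"
  where
  "GIT_cone n act Y w = \<Inter>{orbit_cone n act I |I. I \<in> orbit_sets n Y \<and> w \<in> orbit_cone n act I}"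

definition GIT_fan ::
  "nat \<Rightarrow> ((nat \<Rightarrow> 'k::field) \<Rightarrow> (nat set \<Rightarrow> 'k) \<Rightarrow> (nat set \<Rightarrow> 'k)) \<Rightarrow> (nat set \<Rightarrow> 'k) set
     \<Rightarrow> (nat \<Rightarrow> rat) set set"
  where
  "GIT_fan n act Y = {GIT_cone n act Y w |w. w \<in> orthant n}"

end

theory Submission
  imports Defs
begin

text \<open>
  Both sides are the set of sign cells, inside the orthant, of the arrangement formed by the
  coordinate hyperplanes and the hyperplanes of the partitions, and such cells always form a fan.
  The index set of a point \<open>u \<and> v\<close> of the cone over the Grassmannian is the edge set of a complete
  multipartite graph, the classes being those of proportional columns of the matrix with rows
  \<open>u\<close>, \<open>v\<close>. The cone spanned by the edges of such a graph consists of the nonnegative vectors in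
  which no class carries more than half of the total weight, so every orbit cone is a union of cells.
  Conversely, a single half-space of a partition, restricted to a face of the orthant, is the orbit
  cone of a suitable complete bipartite graph.
\<close>

section \<open>Linear algebra over the rationals\<close>

text \<open>A face in the definition of a fan is cut out by an arbitrary linear form, and the
  subdivision chooses the sides of its hyperplanes independently of one another. In both places the
  result is a cone on which every normal has constant sign, and a point of its relative interior
  identifies it as a single cell; this replaces any bookkeeping of consistent sign patterns. The
  bound of half the total weight comes from the fact that an edge has at most one end in each class.
  The vertex 0 behaves differently: the weights have no coordinate for it, so any weight placed
  there is free. It can make up a shortage on the side of its own class, while every vertex outside
  that class is joined to it and can be covered on its own. Hence if column 0 is nonzero, only the
  class of 0 imposes a condition, and the argument splits according to whether column 0 vanishes.
  The same freedom yields the half-spaces: adding 0 to the lighter block turns the balance equation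
  of a bipartite graph into an inequality.\<close>

lemma dot_add: "dot n u (\<lambda>i. x i + y i) = dot n u x + dot n u y"
  by (simp add: dot_def algebra_simps sum.distrib)

lemma dot_scale: "dot n u (\<lambda>i. c * x i) = c * dot n u x"
  by (simp add: dot_def algebra_simps sum_distrib_left)

lemma dot_scale_left: "dot n (\<lambda>i. c * u i) x = c * dot n u x"
  by (simp add: dot_def algebra_simps sum_distrib_left)

lemma dot_uminus_left: "dot n (\<lambda>i. - u i) x = - dot n u x"
  by (simp add: dot_def sum_negf)

lemma dot_zero_right: "dot n u (\<lambda>i. 0) = 0"
  by (simp add: dot_def)

lemma dot_sum_left: "dot n (\<lambda>i. \<Sum>f\<in>G. f i) x = (\<Sum>f\<in>G. dot n f x)"
  unfolding dot_def sum_distrib_right by (rule sum.swap)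

lemma dot_unit_vec:
  assumes "i \<in> {1..n}"
  shows "dot n (unit_vec i) x = x i"
proof -
  have "dot n (unit_vec i) x = (\<Sum>j\<in>{1..n}. if j = i then x i else 0)"
    unfolding dot_def by (rule sum.cong) (auto simp: unit_vec_def)
  then show ?thesis using assms by simp
qed

lemma dot_unit_vec_right:
  assumes "i \<in> {1..n}"
  shows "dot n u (unit_vec i) = u i"
  using dot_unit_vec[OF assms, of u] by (simp add: dot_def mult.commute)

lemma coord_space_uminus: "x \<in> coord_space S \<Longrightarrow> (\<lambda>i. - x i :: rat) \<in> coord_space S"
  by (simp add: coord_space_def)

lemma orthant_iff: "x \<in> orthant n \<longleftrightarrow> x \<in> coord_space {1..n} \<and> (\<forall>i. 0 \<le> x i)"
  by (force simp: orthant_def coord_space_def)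


section \<open>The fan of an arrangement\<close>

text \<open>Closure under negation lets conditions of the single form \<open>0 <= dot n u x\<close>
  express all three signs: an equation is the conjunction for \<open>u\<close> and its
  negative.\<close>

locale arrangement =
  fixes n :: nat and F :: "(nat \<Rightarrow> rat) set"
  assumes finite_normals: "finite F"
    and normals_coord: "F \<subseteq> coord_space {1..n}"
    and normals_uminus: "u \<in> F \<Longrightarrow> (\<lambda>i. - u i) \<in> F"
begin

text \<open>For \<open>w\<close> in the coordinate space this is the closed cell having
  \<open>w\<close> in its relative interior. A normal vanishing at \<open>w\<close> is tested
  together with its negative, which forces it to vanish on the whole cell.\<close>

definition cell :: "(nat \<Rightarrow> rat) \<Rightarrow> (nat \<Rightarrow> rat) set" where
  "cell w = {x \<in> coord_space {1..n}. \<forall>u\<in>F. 0 \<le> dot n u w \<longrightarrow> 0 \<le> dot n u x}"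

lemma cell_nonpos:
  assumes "x \<in> cell w" "u \<in> F" "dot n u w \<le> 0"
  shows "dot n u x \<le> 0"
  using assms normals_uminus[OF assms(2)] by (force simp: cell_def dot_uminus_left)

lemma cell_zero:
  assumes "x \<in> cell w" "u \<in> F" "dot n u w = 0"
  shows "dot n u x = 0"
proof -
  have "dot n u x \<le> 0" by (rule cell_nonpos[OF assms(1,2)]) (simp add: assms(3))
  moreover have "0 \<le> dot n u x" using assms by (simp add: cell_def)
  ultimately show ?thesis by simp
qed

lemma cell_trans: "x \<in> cell w' \<Longrightarrow> w' \<in> cell w \<Longrightarrow> x \<in> cell w"
  by (auto simp: cell_def)

lemma cell_self: "w \<in> coord_space {1..n} \<Longrightarrow> w \<in> cell w"
  by (simp add: cell_def)

lemma finite_cells: "finite (range cell)"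
proof -
  have "range cell \<subseteq> (\<lambda>G. {x \<in> coord_space {1..n}. \<forall>u\<in>G. 0 \<le> dot n u x}) ` Pow F"
  proof
    fix \<sigma> assume "\<sigma> \<in> range cell"
    then obtain w where "\<sigma> = cell w" by blast
    then have "\<sigma> = {x \<in> coord_space {1..n}. \<forall>u\<in>{u\<in>F. 0 \<le> dot n u w}. 0 \<le> dot n u x}"
      by (auto simp: cell_def)
    then show "\<sigma> \<in> (\<lambda>G. {x \<in> coord_space {1..n}. \<forall>u\<in>G. 0 \<le> dot n u x}) ` Pow F" by blast
  qed
  then show ?thesis using finite_normals by (meson finite_Pow_iff finite_imageI finite_subset)
qed

lemma polyhedral_cell: "polyhedral_cone n (cell w)"
  unfolding polyhedral_cone_def
  by (rule exI[of _ "{u\<in>F. 0 \<le> dot n u w}"])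
    (use finite_normals normals_coord in \<open>auto simp: cell_def\<close>)

text \<open>A sum of enough points of \<open>C\<close> lies in the relative interior.\<close>

lemma ex_relative_interior:
  assumes zero: "(\<lambda>i. 0) \<in> C"
    and add: "\<And>x y. x \<in> C \<Longrightarrow> y \<in> C \<Longrightarrow> (\<lambda>i. x i + y i) \<in> C"
    and sub: "C \<subseteq> coord_space {1..n}"
    and sign: "\<And>u. u \<in> F \<Longrightarrow> (\<forall>x\<in>C. 0 \<le> dot n u x) \<or> (\<forall>x\<in>C. dot n u x \<le> 0)"
  obtains w where "w \<in> C" "C \<subseteq> cell w"
proof -
  have "\<exists>w\<in>C. \<forall>u\<in>G. (\<exists>x\<in>C. 0 < dot n u x) \<longrightarrow> 0 < dot n u w"
    if "finite G" "\<forall>u\<in>G. \<forall>x\<in>C. 0 \<le> dot n u x" for G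
    using that
  proof (induction G)
    case empty
    then show ?case using zero by blast
  next
    case (insert v G)
    then obtain w where w: "w \<in> C" "\<forall>u\<in>G. (\<exists>x\<in>C. 0 < dot n u x) \<longrightarrow> 0 < dot n u w" by auto
    show ?case
    proof (cases "\<exists>x\<in>C. 0 < dot n v x")
      case True
      then obtain x where x: "x \<in> C" "0 < dot n v x" by blast
      show ?thesis
      proof (intro bexI[OF _ add[OF w(1) x(1)]] ballI impI)
        fix u assume "u \<in> insert v G" "\<exists>x\<in>C. 0 < dot n u x"
        then consider "u = v" | "u \<in> G" "0 < dot n u w" using w(2) by blast
        then show "0 < dot n u (\<lambda>i. w i + x i)"
          unfolding dot_add
          by cases (use insert.prems w(1) x in \<open>auto intro: add_pos_nonneg add_nonneg_pos\<close>)
      qed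
    next
      case False
      then show ?thesis using w by blast
    qed
  qed
  from this[of "{u\<in>F. \<forall>x\<in>C. 0 \<le> dot n u x}"] finite_normals
  obtain w where w: "w \<in> C"
      "\<And>u x. u \<in> F \<Longrightarrow> \<forall>x\<in>C. 0 \<le> dot n u x \<Longrightarrow> x \<in> C \<Longrightarrow> 0 < dot n u x \<Longrightarrow> 0 < dot n u w"
    by auto
  \<comment> \<open>If \<open>u\<close> is negative at some point of \<open>C\<close>, then by
    \<open>sign\<close> its negative is nonnegative on \<open>C\<close> and positive somewhere,
    hence positive at \<open>w\<close>, so \<open>u\<close> is not among the normals tested by
    \<open>cell w\<close>.\<close>
  have "0 \<le> dot n u x" if "x \<in> C" "u \<in> F" "0 \<le> dot n u w" for u x
  proof (rule ccontr)
    assume neg: "\<not> 0 \<le> dot n u x"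
    then have "\<forall>x\<in>C. 0 \<le> dot n (\<lambda>i. - u i) x"
      using sign[OF that(2)] that(1) by (auto simp: dot_uminus_left)
    from w(2)[OF normals_uminus[OF that(2)] this that(1)] neg that(3)
    show False by (simp add: dot_uminus_left)
  qed
  then have "C \<subseteq> cell w" using sub by (auto simp: cell_def)
  with w(1) show ?thesis by (rule that)
qed

text \<open>The form \<open>g\<close> defining the face need not be a normal. Take \<open>w'\<close>
  in the relative interior of the face. For \<open>x\<close> in \<open>cell w'\<close> the point
  \<open>w' - e x\<close> stays in \<open>cell w\<close> for small \<open>e > 0\<close>, so
  \<open>g\<close> is nonnegative there; as \<open>g\<close> vanishes at \<open>w'\<close>, this
  gives \<open>g x <= 0\<close>, and therefore \<open>g x = 0\<close>.\<close>

lemma face_of_cell: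
  assumes "face_of_cone n \<tau> (cell w)"
  obtains w' where "w' \<in> cell w" "\<tau> = cell w'"
proof -
  obtain g where g: "\<And>x. x \<in> cell w \<Longrightarrow> 0 \<le> dot n g x" "\<tau> = {x \<in> cell w. dot n g x = 0}"
    using assms by (auto simp: face_of_cone_def)
  have "\<exists>w'\<in>\<tau>. \<tau> \<subseteq> cell w'"
  proof (rule ex_relative_interior[of \<tau>])
    show "(\<lambda>i. 0) \<in> \<tau>"
      by (simp add: g(2) cell_def coord_space_def dot_zero_right)
    show "(\<lambda>i. x i + y i) \<in> \<tau>" if "x \<in> \<tau>" "y \<in> \<tau>" for x y
      using that by (auto simp: g(2) cell_def coord_space_def dot_add)
    show "\<tau> \<subseteq> coord_space {1..n}" by (auto simp: g(2) cell_def)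
    show "(\<forall>x\<in>\<tau>. 0 \<le> dot n u x) \<or> (\<forall>x\<in>\<tau>. dot n u x \<le> 0)" if "u \<in> F" for u
      using that cell_nonpos by (cases "0 \<le> dot n u w") (auto simp: g(2) cell_def)
  qed blast
  then obtain w' where w': "w' \<in> cell w" "dot n g w' = 0" "\<tau> \<subseteq> cell w'"
    by (auto simp: g(2))
  have "dot n g x = 0" if x: "x \<in> cell w'" for x
  proof -
    \<comment> \<open>One \<open>e\<close> must serve all normals that are positive at
      \<open>w'\<close>; finiteness gives it as an iterated minimum.\<close>
    have scale: "\<exists>e>0. \<forall>u\<in>G. e * dot n u x \<le> dot n u w'" if "finite G" "\<forall>u\<in>G. 0 < dot n u w'" for G
      using that
    proof (induction G)
      case empty
      show ?case by (rule exI[of _ 1]) simp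
    next
      case (insert u G)
      then obtain e where e: "e > 0" "\<forall>u\<in>G. e * dot n u x \<le> dot n u w'" by auto
      \<comment> \<open>The summand 1 keeps the denominator positive when the normal vanishes at
        \<open>x\<close>.\<close>
      define d where "d = min e (dot n u w' / (\<bar>dot n u x\<bar> + 1))"
      have "d > 0" using e insert.prems by (simp add: d_def)
      have dv: "d * dot n v x \<le> dot n v w'" if "v \<in> G" for v
      proof (cases "dot n v x \<ge> 0")
        case True
        have "d * dot n v x \<le> e * dot n v x"
          by (rule mult_right_mono) (use True in \<open>auto simp: d_def\<close>)
        then show ?thesis using e that by force
      next
        case False
        then have "d * dot n v x \<le> 0" using \<open>d > 0\<close> by (simp add: mult_le_0_iff)
        then show ?thesis using insert.prems that by force
      qed
      have "d * dot n u x \<le> d * (\<bar>dot n u x\<bar> + 1)"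
        by (rule mult_left_mono) (use \<open>d > 0\<close> in auto)
      also have "\<dots> \<le> dot n u w' / (\<bar>dot n u x\<bar> + 1) * (\<bar>dot n u x\<bar> + 1)"
        by (rule mult_right_mono) (auto simp: d_def)
      also have "\<dots> = dot n u w'"
      proof -
        have "\<bar>dot n u x\<bar> + 1 \<noteq> 0" using abs_ge_zero[of "dot n u x"] by linarith
        then show ?thesis by simp
      qed
      finally show ?case using \<open>d > 0\<close> dv by blast
    qed
    have "\<exists>e>0. \<forall>u\<in>{u\<in>F. 0 < dot n u w'}. e * dot n u x \<le> dot n u w'"
      by (rule scale) (use finite_normals in simp_all)
    then obtain e where e: "e > 0" "\<And>u. u \<in> F \<Longrightarrow> 0 < dot n u w' \<Longrightarrow> e * dot n u x \<le> dot n u w'"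
      by blast
    have xw: "x \<in> cell w" using x w'(1) by (rule cell_trans)
    have dd: "dot n u (\<lambda>i. w' i + (- e) * x i) = dot n u w' - e * dot n u x" for u
      using dot_add[of n u w' "\<lambda>i. (- e) * x i"] dot_scale[of n u "- e" x] by simp
    have "(\<lambda>i. w' i + (- e) * x i) \<in> cell w"
      unfolding cell_def
    proof (intro CollectI conjI ballI impI)
      show "(\<lambda>i. w' i + (- e) * x i) \<in> coord_space {1..n}"
        using x w'(1) by (auto simp: cell_def coord_space_def)
      fix u assume u: "u \<in> F" "0 \<le> dot n u w"
      then have "0 \<le> dot n u w'" using w'(1) by (simp add: cell_def)
      then consider "0 < dot n u w'" | "dot n u w' = 0" by linarith
      \<comment> \<open>A normal vanishing at \<open>w'\<close> also vanishes at \<open>x\<close>,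
        so moving along \<open>x\<close> does not change it; the others are controlled by the choice
        of \<open>e\<close>.\<close>
      then show "0 \<le> dot n u (\<lambda>i. w' i + (- e) * x i)"
        unfolding dd by cases (use e u cell_zero[OF x u(1)] in auto)
    qed
    from g(1)[OF this] have "0 \<le> - (e * dot n g x)" using w'(2) unfolding dd by simp
    then have "dot n g x \<le> 0" using e(1) by (simp add: mult_le_0_iff)
    then show ?thesis using g(1)[OF xw] by simp
  qed
  then have "\<tau> = cell w'" using w' cell_trans by (auto simp: g(2))
  with w'(1) show ?thesis by (rule that)
qed

text \<open>The normals in \<open>G\<close> separate the two cells weakly. On \<open>cell w\<close>
  they are nonnegative, and membership in \<open>cell w'\<close> means that they all vanish, so
  their sum is one supporting form for the whole intersection.\<close>

lemma face_cell_Int: "face_of_cone n (cell w \<inter> cell w') (cell w)"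
proof -
  define G where "G = {f\<in>F. 0 \<le> dot n f w \<and> dot n f w' \<le> 0}"
  have fin: "finite G" using finite_normals by (simp add: G_def)
  have nonneg: "0 \<le> dot n f x" if "f \<in> G" "x \<in> cell w" for f x
    using that by (simp add: G_def cell_def)
  have "x \<in> cell w' \<longleftrightarrow> (\<forall>f\<in>G. dot n f x = 0)" if x: "x \<in> cell w" for x
  proof
    assume "x \<in> cell w'"
    then show "\<forall>f\<in>G. dot n f x = 0"
      using cell_nonpos nonneg x by (fastforce simp: G_def intro: order_antisym)
  next
    assume z: "\<forall>f\<in>G. dot n f x = 0"
    have "0 \<le> dot n u x" if "u \<in> F" "0 \<le> dot n u w'" for u
    proof (cases "0 \<le> dot n u w")
      case True
      then show ?thesis using x that by (simp add: cell_def)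
    next
      case False
      then have "(\<lambda>i. - u i) \<in> G"
        using that normals_uminus by (auto simp: G_def dot_uminus_left)
      then have "dot n (\<lambda>i. - u i) x = 0" using z by blast
      then show ?thesis by (simp add: dot_uminus_left)
    qed
    then show "x \<in> cell w'" using x by (simp add: cell_def)
  qed
  then have "cell w \<inter> cell w' = {x \<in> cell w. (\<Sum>f\<in>G. dot n f x) = 0}"
    using fin nonneg by (auto simp: sum_nonneg_eq_0_iff)
  moreover have "0 \<le> (\<Sum>f\<in>G. dot n f x)" if "x \<in> cell w" for x
    using that nonneg by (simp add: sum_nonneg)
  moreover have "(\<lambda>i. \<Sum>f\<in>G. f i) \<in> coord_space {1..n}"
    using normals_coord by (auto simp: G_def coord_space_def intro!: sum.neutral)
  ultimately show ?thesis
    unfolding face_of_cone_def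
    by (intro bexI[of _ "\<lambda>i. \<Sum>f\<in>G. f i"]) (simp_all add: dot_sum_left)
qed

text \<open>A face of \<open>cell w\<close> is the cell of one of its points, so stability of
  \<open>W\<close> under \<open>cell\<close> is what keeps the family closed under faces;
  pointedness is inherited from \<open>W\<close>.\<close>

lemma is_fan_cells:
  assumes "\<And>w. w \<in> W \<Longrightarrow> cell w \<subseteq> W" "pointed_cone W"
  shows "is_fan n (cell ` W)"
  unfolding is_fan_def
proof (intro conjI ballI allI impI)
  show "finite (cell ` W)" using finite_cells by (rule finite_subset[rotated]) blast
next
  fix \<sigma> assume "\<sigma> \<in> cell ` W"
  then obtain w where w: "w \<in> W" "\<sigma> = cell w" by blast
  show "polyhedral_cone n \<sigma>" by (simp add: w(2) polyhedral_cell)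
  show "pointed_cone \<sigma>" using assms(1)[OF w(1)] assms(2) by (auto simp: w(2) pointed_cone_def)
  show "\<tau> \<in> cell ` W" if face: "face_of_cone n \<tau> \<sigma>" for \<tau>
  proof -
    obtain w' where "w' \<in> cell w" "\<tau> = cell w'"
      by (rule face_of_cell[OF face[unfolded w(2)]])
    then show ?thesis using assms(1)[OF w(1)] by blast
  qed
next
  fix \<sigma> \<sigma>' assume "\<sigma> \<in> cell ` W" "\<sigma>' \<in> cell ` W"
  then show "face_of_cone n (\<sigma> \<inter> \<sigma>') \<sigma>" "face_of_cone n (\<sigma> \<inter> \<sigma>') \<sigma>'"
    using face_cell_Int by (auto simp: Int_commute)
qed

end


section \<open>The hyperplanes of two-block partitions\<close>

text \<open>A normal of the hyperplane belonging to the blocks \<open>A\<close> and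
  \<open>{1..n} - A\<close>, with \<open>A\<close> on the positive side. Exchanging the blocks
  negates it.\<close>

definition split_vec :: "nat \<Rightarrow> nat set \<Rightarrow> nat \<Rightarrow> rat" where
  "split_vec n A = (\<lambda>i. if i \<in> A then 1 else if i \<in> {1..n} then - 1 else 0)"

lemma split_vec_coord: "A \<subseteq> {1..n} \<Longrightarrow> split_vec n A \<in> coord_space {1..n}"
  by (auto simp: split_vec_def coord_space_def)

lemma split_vec_compl: "A \<subseteq> {1..n} \<Longrightarrow> split_vec n ({1..n} - A) = (\<lambda>i. - split_vec n A i)"
  by (auto simp: split_vec_def fun_eq_iff)

lemma dot_split_vec:
  assumes "A \<subseteq> {1..n}"
  shows "dot n (split_vec n A) x = sum x A - sum x ({1..n} - A)"
proof -
  have "dot n (split_vec n A) x =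
      (\<Sum>i\<in>A. split_vec n A i * x i) + (\<Sum>i\<in>{1..n} - A. split_vec n A i * x i)"
    unfolding dot_def using assms by (simp add: sum.subset_diff add.commute)
  also have "(\<Sum>i\<in>A. split_vec n A i * x i) = sum x A"
    by (rule sum.cong) (auto simp: split_vec_def)
  also have "(\<Sum>i\<in>{1..n} - A. split_vec n A i * x i) = (\<Sum>i\<in>{1..n} - A. - x i)"
    by (rule sum.cong) (auto simp: split_vec_def)
  finally show ?thesis by (simp add: sum_negf)
qed

text \<open>The improper blocks \<open>\<emptyset>\<close> and \<open>{1..n}\<close> are allowed: their normals do not subdivide the orthant.\<close>

definition wall_normals :: "nat \<Rightarrow> (nat \<Rightarrow> rat) set" where
  "wall_normals n = unit_vec ` {1..n} \<union> (\<lambda>i j. - unit_vec i j) ` {1..n} \<union> split_vec n ` Pow {1..n}"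

interpretation walls: arrangement n "wall_normals n" for n
proof
  show "finite (wall_normals n)" by (simp add: wall_normals_def)
  show "wall_normals n \<subseteq> coord_space {1..n}"
    using split_vec_coord by (auto simp: wall_normals_def coord_space_def unit_vec_def)
  show "(\<lambda>i. - u i) \<in> wall_normals n" if u: "u \<in> wall_normals n" for u
  proof -
    from u consider i where "i \<in> {1..n}" "u = unit_vec i" | i where "i \<in> {1..n}" "u = (\<lambda>j. - unit_vec i j)"
      | A where "A \<subseteq> {1..n}" "u = split_vec n A"
      by (auto simp: wall_normals_def)
    then show ?thesis
    proof cases
      case 3
      then show ?thesis
        unfolding wall_normals_def split_vec_compl[OF 3(1), symmetric] 3(2) by blast
    qed (auto simp: wall_normals_def)
  qed
qed

abbreviation wall_cell :: "nat \<Rightarrow> (nat \<Rightarrow> rat) \<Rightarrow> (nat \<Rightarrow> rat) set" where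
  "wall_cell n \<equiv> walls.cell n"

lemma split_vec_in_walls: "A \<subseteq> {1..n} \<Longrightarrow> split_vec n A \<in> wall_normals n"
  by (auto simp: wall_normals_def)

lemma unit_vec_in_walls: "i \<in> {1..n} \<Longrightarrow> unit_vec i \<in> wall_normals n"
  by (auto simp: wall_normals_def)

text \<open>At a point of the orthant every \<open>unit_vec i\<close> is nonnegative, which keeps
  the cell in the orthant; its negative is active only when \<open>w i = 0\<close>, which yields the
  condition on supports.\<close>

lemma wall_cell_iff:
  assumes "w \<in> orthant n"
  shows "x \<in> wall_cell n w \<longleftrightarrow> x \<in> orthant n \<and> (\<forall>i. w i = 0 \<longrightarrow> x i = 0) \<and>
    (\<forall>A\<subseteq>{1..n}. 0 \<le> dot n (split_vec n A) w \<longrightarrow> 0 \<le> dot n (split_vec n A) x)"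
    (is "_ \<longleftrightarrow> ?rhs")
proof
  assume x: "x \<in> wall_cell n w"
  have "0 \<le> x i" if "i \<in> {1..n}" for i
    using x assms unit_vec_in_walls[OF that] that
    by (force simp: walls.cell_def dot_unit_vec orthant_def)
  moreover have "x i = 0" if "w i = 0" for i
  proof (cases "i \<in> {1..n}")
    case True
    then show ?thesis
      using walls.cell_zero[OF x unit_vec_in_walls[OF True]] that by (simp add: dot_unit_vec)
  next
    case False
    then show ?thesis using x by (simp add: walls.cell_def coord_space_def)
  qed
  ultimately show ?rhs
    using x split_vec_in_walls by (auto simp: walls.cell_def orthant_def)
next
  assume x: ?rhs
  have "0 \<le> dot n u x" if u: "u \<in> wall_normals n" "0 \<le> dot n u w" for u
  proof -
    from u(1) consider i where "i \<in> {1..n}" "u = unit_vec i" | i where "i \<in> {1..n}" "u = (\<lambda>j. - unit_vec i j)"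
      | A where "A \<subseteq> {1..n}" "u = split_vec n A"
      by (auto simp: wall_normals_def)
    then show ?thesis
    proof cases
      case 1
      then show ?thesis using x by (simp add: dot_unit_vec orthant_def)
    next
      case 2
      then have "w i = 0" using u(2) assms
        by (force simp: dot_unit_vec dot_uminus_left orthant_def)
      then show ?thesis using x 2 by (simp add: dot_unit_vec dot_uminus_left)
    next
      case 3
      then show ?thesis using x u by simp
    qed
  qed
  then show "x \<in> wall_cell n w" using x by (simp add: walls.cell_def orthant_def)
qed

lemma pointed_orthant: "pointed_cone (orthant n)"
proof -
  have "x i = 0" if "x \<in> orthant n" "(\<lambda>i. - x i) \<in> orthant n" for x :: "nat \<Rightarrow> rat" and i
  proof -
    have "0 \<le> x i" "0 \<le> - x i" using that unfolding orthant_iff by blast+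
    then show ?thesis by simp
  qed
  then show ?thesis by (auto simp: pointed_cone_def)
qed


section \<open>Cells of the subdivision\<close>

text \<open>Testing a supporting form on unit vectors shows that its coefficients are nonnegative. A
  sum of nonnegative terms vanishes only termwise, so \<open>S\<close> is the support of the form;
  conversely the indicator of \<open>S\<close> is such a form.\<close>

lemma face_of_orthant_iff:
  "face_of_cone n \<tau> (orthant n) \<longleftrightarrow> (\<exists>S\<subseteq>{1..n}. \<tau> = {x \<in> orthant n. \<forall>i\<in>S. x i = 0})"
proof
  assume "face_of_cone n \<tau> (orthant n)"
  then obtain u where u: "u \<in> coord_space {1..n}" "\<And>x. x \<in> orthant n \<Longrightarrow> 0 \<le> dot n u x"
      "\<tau> = {x \<in> orthant n. dot n u x = 0}"
    by (auto simp: face_of_cone_def)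
  have u0: "0 \<le> u i" if "i \<in> {1..n}" for i
  proof -
    have "unit_vec i \<in> orthant n" using that by (auto simp: orthant_def coord_space_def unit_vec_def)
    then show ?thesis using u(2) that dot_unit_vec_right by fastforce
  qed
  have "dot n u x = 0 \<longleftrightarrow> (\<forall>i\<in>{i\<in>{1..n}. u i \<noteq> 0}. x i = 0)" if "x \<in> orthant n" for x
    unfolding dot_def using u0 that
    by (subst sum_nonneg_eq_0_iff) (auto simp: orthant_def)
  then have "\<tau> = {x \<in> orthant n. \<forall>i\<in>{i\<in>{1..n}. u i \<noteq> 0}. x i = 0}" unfolding u(3) by blast
  then show "\<exists>S\<subseteq>{1..n}. \<tau> = {x \<in> orthant n. \<forall>i\<in>S. x i = 0}" by blast
next
  assume "\<exists>S\<subseteq>{1..n}. \<tau> = {x \<in> orthant n. \<forall>i\<in>S. x i = 0}"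
  then obtain S where S: "S \<subseteq> {1..n}" "\<tau> = {x \<in> orthant n. \<forall>i\<in>S. x i = 0}" by blast
  define u :: "nat \<Rightarrow> rat" where "u = (\<lambda>i. of_bool (i \<in> S))"
  have "u \<in> coord_space {1..n}" using S by (auto simp: u_def coord_space_def)
  moreover have "0 \<le> dot n u x" if "x \<in> orthant n" for x
    using that by (auto simp: dot_def u_def orthant_def intro!: sum_nonneg)
  moreover have "dot n u x = 0 \<longleftrightarrow> (\<forall>i\<in>S. x i = 0)" if "x \<in> orthant n" for x
    unfolding dot_def using that S(1)
    by (subst sum_nonneg_eq_0_iff) (auto simp: orthant_def u_def)
  ultimately show "face_of_cone n \<tau> (orthant n)"
    unfolding face_of_cone_def S(2) by (intro bexI[of _ u]) auto
qed

definition hyperplane_of :: "nat \<Rightarrow> (nat \<Rightarrow> rat) \<Rightarrow> (nat \<Rightarrow> rat) set" where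
  "hyperplane_of n u = {x \<in> coord_space {1..n}. dot n u x = 0}"

text \<open>Needed because \<open>hyperplane_sides\<close> ranges over all normals of a hyperplane,
  which must be reduced to multiples of a given one.\<close>

lemma hyperplane_normal_unique:
  assumes u: "u \<in> coord_space {1..n}" "u \<noteq> (\<lambda>i. 0)"
    and v: "v \<in> coord_space {1..n}" "v \<noteq> (\<lambda>i. 0)"
    and eq: "hyperplane_of n u = hyperplane_of n v"
  obtains c where "c \<noteq> 0" "v = (\<lambda>i. c * u i)"
proof -
  obtain k where k: "u k \<noteq> 0" using u(2) by auto
  then have kn: "k \<in> {1..n}" using u(1) by (auto simp: coord_space_def)
  have rel: "u k * v i = u i * v k" for i
  proof (cases "i \<in> {1..n}")
    case True
    \<comment> \<open>This vector is orthogonal to \<open>u\<close>; that it is also orthogonal to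
      \<open>v\<close> is the proportionality of the entries \<open>i\<close> and
      \<open>k\<close>.\<close>
    define x where "x = (\<lambda>j. u k * unit_vec i j + (- u i) * unit_vec k j)"
    have d: "dot n y x = u k * y i - u i * y k" for y
      unfolding x_def dot_add dot_scale
      by (simp only: dot_unit_vec_right[OF True] dot_unit_vec_right[OF kn])
    have "x \<in> coord_space {1..n}" using True kn by (auto simp: x_def coord_space_def unit_vec_def)
    then have "x \<in> hyperplane_of n u" by (simp add: hyperplane_of_def d)
    then have "x \<in> hyperplane_of n v" using eq by simp
    then have "dot n v x = 0" by (simp add: hyperplane_of_def)
    then show ?thesis by (simp add: d)
  next
    case False
    then show ?thesis using u v by (simp add: coord_space_def)
  qed
  have "v = (\<lambda>i. v k / u k * u i)" using rel k by (auto simp: field_simps)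
  moreover have "v k / u k \<noteq> 0" using v(2) calculation by auto
  ultimately show ?thesis using that by blast
qed

lemma hyperplane_sides_hyperplane_of:
  assumes u: "u \<in> coord_space {1..n}" "u \<noteq> (\<lambda>i. 0)"
  shows "hyperplane_sides n (hyperplane_of n u) = {hyperplane_of n u,
    {x \<in> coord_space {1..n}. 0 \<le> dot n u x}, {x \<in> coord_space {1..n}. dot n u x \<le> 0}}"
    (is "_ = {?H, ?P, ?N}")
proof
  show "hyperplane_sides n ?H \<subseteq> {?H, ?P, ?N}"
  proof
    fix \<sigma> assume "\<sigma> \<in> hyperplane_sides n ?H"
    then obtain v where v: "v \<in> coord_space {1..n}" "v \<noteq> (\<lambda>i. 0)" "?H = hyperplane_of n v"
        "\<sigma> = ?H \<or> \<sigma> = {x \<in> coord_space {1..n}. 0 \<le> dot n v x}"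
      unfolding hyperplane_sides_def hyperplane_of_def by blast
    obtain c where c: "c \<noteq> 0" "v = (\<lambda>i. c * u i)"
      using hyperplane_normal_unique[OF u v(1-3)] by blast
    show "\<sigma> \<in> {?H, ?P, ?N}"
    proof (cases "c > 0")
      case True
      then have "{x \<in> coord_space {1..n}. 0 \<le> dot n v x} = ?P"
        by (auto simp: c(2) dot_scale_left zero_le_mult_iff)
      then show ?thesis using v(4) by auto
    next
      case False
      then have "{x \<in> coord_space {1..n}. 0 \<le> dot n v x} = ?N"
        using c(1) by (auto simp: c(2) dot_scale_left zero_le_mult_iff)
      then show ?thesis using v(4) by auto
    qed
  qed
  have "?H \<in> hyperplane_sides n ?H" "?P \<in> hyperplane_sides n ?H"
    using u by (auto simp: hyperplane_sides_def hyperplane_of_def intro!: bexI[of _ u])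
  moreover have "?N \<in> hyperplane_sides n ?H"
    unfolding hyperplane_sides_def
    by (intro CollectI bexI[of _ "\<lambda>i. - u i"])
      (use u in \<open>auto simp: hyperplane_of_def dot_uminus_left coord_space_def fun_eq_iff\<close>)
  ultimately show "{?H, ?P, ?N} \<subseteq> hyperplane_sides n ?H" by blast
qed

lemma two_block_partitions_eq:
  "two_block_partitions n = (\<lambda>A. {A, {1..n} - A}) ` (Pow {1..n} - {{}, {1..n}})"
proof (intro equalityI subsetI)
  fix R assume "R \<in> two_block_partitions n"
  then have p: "partition_on {1..n} R" and "card R = 2" by (auto simp: two_block_partitions_def)
  then obtain A B where R: "R = {A, B}" "A \<noteq> B" by (auto simp: card_2_iff)
  have "A \<inter> B = {}" using partition_onD2[OF p] R by (auto simp: disjoint_def)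
  moreover have "A \<union> B = {1..n}" using partition_onD1[OF p] R by auto
  moreover have "A \<noteq> {}" "B \<noteq> {}" using partition_onD3[OF p] R by auto
  ultimately have "B = {1..n} - A" "A \<in> Pow {1..n} - {{}, {1..n}}" by auto
  then show "R \<in> (\<lambda>A. {A, {1..n} - A}) ` (Pow {1..n} - {{}, {1..n}})" using R by blast
next
  fix R assume "R \<in> (\<lambda>A. {A, {1..n} - A}) ` (Pow {1..n} - {{}, {1..n}})"
  then obtain A where A: "A \<subseteq> {1..n}" "A \<noteq> {}" "A \<noteq> {1..n}" "R = {A, {1..n} - A}" by auto
  have "A \<noteq> {1..n} - A" using A by blast
  then have "card R = 2" using A(4) by simp
  moreover have "partition_on {1..n} R"
    unfolding partition_on_def disjoint_def using A by auto
  ultimately show "R \<in> two_block_partitions n" by (simp add: two_block_partitions_def)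
qed

lemma partition_hyperplane_eq:
  assumes "A \<subseteq> {1..n}"
  shows "partition_hyperplane n {A, {1..n} - A} = hyperplane_of n (split_vec n A)"
proof -
  have "{1..n} - ({1..n} - A) = A" using assms by blast
  then show ?thesis
    using assms by (auto simp: partition_hyperplane_def hyperplane_of_def dot_split_vec)
qed

lemma partition_hyperplanes_eq:
  "partition_hyperplane n ` two_block_partitions n =
    (\<lambda>A. hyperplane_of n (split_vec n A)) ` (Pow {1..n} - {{}, {1..n}})"
  unfolding two_block_partitions_eq image_image
  by (rule image_cong[OF refl], rule partition_hyperplane_eq) blast

lemma split_vec_nonzero: "A \<subseteq> {1..n} \<Longrightarrow> A \<noteq> {} \<Longrightarrow> split_vec n A \<noteq> (\<lambda>i. 0)"
  by (auto simp: split_vec_def fun_eq_iff)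

lemma dot_split_vec_trivial:
  assumes "x \<in> orthant n"
  shows "dot n (split_vec n {}) x \<le> 0" "0 \<le> dot n (split_vec n {1..n}) x"
proof -
  have "0 \<le> sum x {1..n}" using assms by (intro sum_nonneg) (auto simp: orthant_def)
  then show "dot n (split_vec n {}) x \<le> 0" "0 \<le> dot n (split_vec n {1..n}) x"
    by (simp_all add: dot_split_vec)
qed

text \<open>For each hyperplane choose the smallest side containing \<open>w\<close>, and for the
  orthant the smallest face containing \<open>w\<close>; together they impose the conditions of the
  cell.\<close>

lemma wall_cell_in_subdivision:
  assumes w: "w \<in> orthant n" and n: "1 \<le> n"
  shows "wall_cell n w \<in> subdivision n (orthant n) (partition_hyperplane n ` two_block_partitions n)"
proof -
  let ?HH = "partition_hyperplane n ` two_block_partitions n"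
  \<comment> \<open>The side must depend on \<open>H\<close> alone, although \<open>A\<close> and
    its complement give the same \<open>H\<close>. Quantifying over all normals avoids choosing one:
    if \<open>w\<close> lies on \<open>H\<close>, both orientations are active and the side is
    \<open>H\<close> itself.\<close>
  define s where "s H = {x \<in> coord_space {1..n}. \<forall>u\<in>coord_space {1..n} - {\<lambda>i. 0}.
    H = hyperplane_of n u \<and> 0 \<le> dot n u w \<longrightarrow> 0 \<le> dot n u x}" for H
  define \<tau> where "\<tau> = {x \<in> orthant n. \<forall>i\<in>{i\<in>{1..n}. w i = 0}. x i = 0}"
  have face: "face_of_cone n \<tau> (orthant n)"
    unfolding face_of_orthant_iff \<tau>_def by blast
  have side: "s H \<in> hyperplane_sides n H" if H: "H \<in> ?HH" for H
  proof -
    obtain A where A: "A \<subseteq> {1..n}" "A \<noteq> {}" "H = hyperplane_of n (split_vec n A)"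
      using H unfolding partition_hyperplanes_eq by blast
    let ?u = "split_vec n A"
    note u = split_vec_coord[OF A(1)] split_vec_nonzero[OF A(1,2)]
    have s: "s H = {x \<in> coord_space {1..n}. \<forall>c. c \<noteq> 0 \<longrightarrow> 0 \<le> c * dot n ?u w \<longrightarrow> 0 \<le> c * dot n ?u x}"
    proof -
      have "(\<forall>v\<in>coord_space {1..n} - {\<lambda>i. 0}. H = hyperplane_of n v \<and> 0 \<le> dot n v w \<longrightarrow> 0 \<le> dot n v x)
        \<longleftrightarrow> (\<forall>c. c \<noteq> 0 \<longrightarrow> 0 \<le> c * dot n ?u w \<longrightarrow> 0 \<le> c * dot n ?u x)" (is "?l \<longleftrightarrow> ?r") for x
      proof
        assume l: ?l
        show ?r
        proof (intro allI impI)
          fix c :: rat assume c: "c \<noteq> 0" "0 \<le> c * dot n ?u w"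
          have "(\<lambda>i. c * ?u i) \<in> coord_space {1..n} - {\<lambda>i. 0}"
            using u c by (auto simp: coord_space_def fun_eq_iff)
          moreover have "H = hyperplane_of n (\<lambda>i. c * ?u i)"
            using c by (auto simp: A(3) hyperplane_of_def dot_scale_left)
          ultimately show "0 \<le> c * dot n ?u x" using l c by (metis dot_scale_left)
        qed
      next
        assume r: ?r
        show ?l
        proof (intro ballI impI)
          fix v assume v: "v \<in> coord_space {1..n} - {\<lambda>i. 0}" "H = hyperplane_of n v \<and> 0 \<le> dot n v w"
          obtain c where c: "c \<noteq> 0" "v = (\<lambda>i. c * ?u i)"
            using hyperplane_normal_unique[OF u, of v] v A(3) by auto
          show "0 \<le> dot n v x" using r v(2) c by (simp add: dot_scale_left)
        qed
      qed
      then show ?thesis unfolding s_def by blast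
    qed
    consider "dot n ?u w = 0" | "dot n ?u w > 0" | "dot n ?u w < 0" by linarith
    then have "s H \<in> {hyperplane_of n ?u,
      {x \<in> coord_space {1..n}. 0 \<le> dot n ?u x}, {x \<in> coord_space {1..n}. dot n ?u x \<le> 0}}"
    proof cases
      case 1
      have "s H = hyperplane_of n ?u"
      proof -
        \<comment> \<open>The scalars 1 and -1 suffice.\<close>
        have "(\<forall>c. c \<noteq> 0 \<longrightarrow> 0 \<le> c * dot n ?u x) \<longleftrightarrow> dot n ?u x = 0" for x
          by (metis mult_1 mult_minus_left mult_zero_right neg_0_le_iff_le order.refl order_antisym zero_neq_neg_one zero_neq_one)
        then show ?thesis unfolding s hyperplane_of_def 1 by simp
      qed
      then show ?thesis by blast
    next
      case 2
      then have "s H = {x \<in> coord_space {1..n}. 0 \<le> dot n ?u x}"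
        unfolding s by (intro Collect_cong conj_cong refl iffI)
          (auto simp: zero_le_mult_iff elim: allE[of _ 1])
      then show ?thesis by blast
    next
      case 3
      then have "s H = {x \<in> coord_space {1..n}. dot n ?u x \<le> 0}"
        unfolding s by (intro Collect_cong conj_cong refl iffI)
          (auto simp: zero_le_mult_iff elim: allE[of _ "-1"])
      then show ?thesis by blast
    qed
    then show ?thesis using hyperplane_sides_hyperplane_of[OF u] A(3) by simp
  qed
  have "x \<in> wall_cell n w \<longleftrightarrow> x \<in> \<tau> \<inter> (\<Inter>H\<in>?HH. s H)" for x
  proof
    assume x: "x \<in> wall_cell n w"
    then have xo: "x \<in> orthant n" "\<And>i. w i = 0 \<Longrightarrow> x i = 0" using wall_cell_iff[OF w] by auto
    have "x \<in> s H" if H: "H \<in> ?HH" for H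
    proof -
      obtain A where A: "A \<subseteq> {1..n}" "A \<noteq> {}" "H = hyperplane_of n (split_vec n A)"
        using H unfolding partition_hyperplanes_eq by blast
      have "0 \<le> dot n v x" if v: "v \<in> coord_space {1..n} - {\<lambda>i. 0}" "H = hyperplane_of n v \<and> 0 \<le> dot n v w" for v
      proof -
        obtain c where c: "c \<noteq> 0" "v = (\<lambda>i. c * split_vec n A i)"
          using hyperplane_normal_unique[OF split_vec_coord[OF A(1)] split_vec_nonzero[OF A(1,2)], of v] v A(3)
          by auto
        show ?thesis
        proof (cases "0 < c")
          case True
          then show ?thesis
            using v(2) x split_vec_in_walls[OF A(1)]
            by (simp add: c(2) dot_scale_left zero_le_mult_iff walls.cell_def)
        next
          case False
          then show ?thesis
            using v(2) c(1) walls.cell_nonpos[OF x split_vec_in_walls[OF A(1)]]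
            by (auto simp: c(2) dot_scale_left zero_le_mult_iff)
        qed
      qed
      then show ?thesis using xo(1) by (simp add: s_def orthant_def)
    qed
    then show "x \<in> \<tau> \<inter> (\<Inter>H\<in>?HH. s H)" using xo by (auto simp: \<tau>_def)
  next
    assume x: "x \<in> \<tau> \<inter> (\<Inter>H\<in>?HH. s H)"
    then have xo: "x \<in> orthant n" by (simp add: \<tau>_def)
    have zero: "x i = 0" if "w i = 0" for i
      using that x by (cases "i \<in> {1..n}") (auto simp: \<tau>_def orthant_def coord_space_def)
    have "0 \<le> dot n (split_vec n A) x" if A: "A \<subseteq> {1..n}" "0 \<le> dot n (split_vec n A) w" for A
    proof -
      consider "A = {1..n}" | "A = {}" | "A \<noteq> {}" "A \<noteq> {1..n}" by blast
      then show ?thesis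
      proof cases
        case 1
        then show ?thesis using dot_split_vec_trivial[OF xo] by simp
      next
        case 2
        \<comment> \<open>The empty block has no hyperplane in the subdivision. Its condition is
          active only if the total weight of \<open>w\<close> is at most 0, which leaves
          \<open>w = 0\<close> and hence \<open>x = 0\<close>.\<close>
        have "w i = 0" if "i \<in> {1..n}" for i
        proof -
          have "sum w {1..n} \<le> 0" using A(2) by (simp add: 2 dot_split_vec)
          moreover have "0 \<le> sum w {1..n}" using w by (intro sum_nonneg) (auto simp: orthant_def)
          ultimately have "sum w {1..n} = 0" by simp
          then show ?thesis using that w sum_nonneg_eq_0_iff[of "{1..n}" w] by (auto simp: orthant_def)
        qed
        then have "x i = 0" if "i \<in> {1..n}" for i using that zero by blast
        then show ?thesis by (simp add: dot_def)
      next
        case 3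
        then have "hyperplane_of n (split_vec n A) \<in> ?HH"
          unfolding partition_hyperplanes_eq using A(1) by blast
        then have "x \<in> s (hyperplane_of n (split_vec n A))" using x by blast
        then show ?thesis
          using A split_vec_coord[OF A(1)] split_vec_nonzero[OF A(1) 3(1)] by (simp add: s_def)
      qed
    qed
    then show "x \<in> wall_cell n w" using xo zero wall_cell_iff[OF w] by blast
  qed
  then have "wall_cell n w = \<tau> \<inter> (\<Inter>H\<in>?HH. s H)" by blast
  then show ?thesis unfolding subdivision_def using face side by blast
qed

text \<open>Independently chosen sides may meet in a smaller cone than the choices suggest, so the
  choices do not directly give the sign pattern of a cell. The pattern is read off at a relative
  interior point \<open>w\<close> of the intersection; conversely, each chosen side contains
  \<open>w\<close> and therefore its whole cell.\<close>

lemma subdivision_cell_is_wall_cell: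
  assumes "C \<in> subdivision n (orthant n) (partition_hyperplane n ` two_block_partitions n)"
  shows "\<exists>w\<in>orthant n. C = wall_cell n w"
proof -
  let ?HH = "partition_hyperplane n ` two_block_partitions n"
  from assms obtain \<tau> s where C: "C = \<tau> \<inter> (\<Inter>H\<in>?HH. s H)" "face_of_cone n \<tau> (orthant n)"
      and side: "\<And>H. H \<in> ?HH \<Longrightarrow> s H \<in> hyperplane_sides n H"
    unfolding subdivision_def by blast
  obtain S where S: "S \<subseteq> {1..n}" "\<tau> = {x \<in> orthant n. \<forall>i\<in>S. x i = 0}"
    using C(2) unfolding face_of_orthant_iff by blast
  have sub: "C \<subseteq> orthant n" by (auto simp: C(1) S(2))
  have side': "s (hyperplane_of n (split_vec n A)) \<in> {hyperplane_of n (split_vec n A),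
      {x \<in> coord_space {1..n}. 0 \<le> dot n (split_vec n A) x},
      {x \<in> coord_space {1..n}. dot n (split_vec n A) x \<le> 0}}"
    and HH: "hyperplane_of n (split_vec n A) \<in> ?HH"
    if "A \<subseteq> {1..n}" "A \<noteq> {}" "A \<noteq> {1..n}" for A
  proof -
    show HH: "hyperplane_of n (split_vec n A) \<in> ?HH"
      unfolding partition_hyperplanes_eq using that by blast
    show "s (hyperplane_of n (split_vec n A)) \<in> {hyperplane_of n (split_vec n A),
      {x \<in> coord_space {1..n}. 0 \<le> dot n (split_vec n A) x},
      {x \<in> coord_space {1..n}. dot n (split_vec n A) x \<le> 0}}"
      using side[OF HH] hyperplane_sides_hyperplane_of[OF split_vec_coord split_vec_nonzero] that by simp
  qed
  have "\<exists>w\<in>C. C \<subseteq> wall_cell n w"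
  proof (rule walls.ex_relative_interior[of C n])
    have "(\<lambda>i. 0) \<in> s H" if H: "H \<in> ?HH" for H
    proof -
      obtain A where A: "A \<subseteq> {1..n}" "A \<noteq> {}" "A \<noteq> {1..n}" "H = hyperplane_of n (split_vec n A)"
        using H unfolding partition_hyperplanes_eq by blast
      show ?thesis using side'[OF A(1-3)]
        by (auto simp: A(4) hyperplane_of_def coord_space_def dot_zero_right)
    qed
    then show "(\<lambda>i. 0) \<in> C"
      by (auto simp: C(1) S(2) orthant_def coord_space_def)
    have "(\<lambda>i. x i + y i) \<in> s H" if H: "H \<in> ?HH" and "x \<in> s H" "y \<in> s H" for H x y
    proof -
      obtain A where A: "A \<subseteq> {1..n}" "A \<noteq> {}" "A \<noteq> {1..n}" "H = hyperplane_of n (split_vec n A)"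
        using H unfolding partition_hyperplanes_eq by blast
      show ?thesis using side'[OF A(1-3)] that
        by (auto simp: A(4) hyperplane_of_def coord_space_def dot_add)
    qed
    moreover have "(\<lambda>i. x i + y i) \<in> \<tau>" if "x \<in> \<tau>" "y \<in> \<tau>" for x y
      using that by (auto simp: S(2) orthant_def coord_space_def)
    ultimately show "(\<lambda>i. x i + y i) \<in> C" if "x \<in> C" "y \<in> C" for x y
      using that by (simp add: C(1))
    show "C \<subseteq> coord_space {1..n}" using sub by (auto simp: orthant_def)
    fix u assume "u \<in> wall_normals n"
    then consider i where "i \<in> {1..n}" "u = unit_vec i" | i where "i \<in> {1..n}" "u = (\<lambda>j. - unit_vec i j)"
      | "u = split_vec n {}" | "u = split_vec n {1..n}"
      | A where "A \<subseteq> {1..n}" "A \<noteq> {}" "A \<noteq> {1..n}" "u = split_vec n A"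
      unfolding wall_normals_def by blast
    then show "(\<forall>x\<in>C. 0 \<le> dot n u x) \<or> (\<forall>x\<in>C. dot n u x \<le> 0)"
    proof cases
      case 1
      then show ?thesis using sub by (auto simp: dot_unit_vec orthant_def)
    next
      case 2
      then show ?thesis using sub by (auto simp: dot_unit_vec dot_uminus_left orthant_def)
    next
      case 3
      then show ?thesis using sub dot_split_vec_trivial by blast
    next
      case 4
      then show ?thesis using sub dot_split_vec_trivial by blast
    next
      case 5
      have "C \<subseteq> s (hyperplane_of n (split_vec n A))" using HH[OF 5(1-3)] by (auto simp: C(1))
      then show ?thesis using side'[OF 5(1-3)] by (auto simp: 5(4) hyperplane_of_def)
    qed
  qed blast
  then obtain w where w: "w \<in> C" "C \<subseteq> wall_cell n w" by blast
  then have wo: "w \<in> orthant n" using sub by blast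
  have "wall_cell n w \<subseteq> C"
  proof
    fix x assume x: "x \<in> wall_cell n w"
    then have xo: "x \<in> orthant n" "\<And>i. w i = 0 \<Longrightarrow> x i = 0" using wall_cell_iff[OF wo] by auto
    have "x \<in> s H" if H: "H \<in> ?HH" for H
    proof -
      obtain A where A: "A \<subseteq> {1..n}" "A \<noteq> {}" "A \<noteq> {1..n}" "H = hyperplane_of n (split_vec n A)"
        using H unfolding partition_hyperplanes_eq by blast
      note F = split_vec_in_walls[OF A(1)]
      have wH: "w \<in> s H" using w(1) H unfolding C(1) by blast
      have xc: "x \<in> coord_space {1..n}" using xo by (simp add: orthant_def)
      consider "s H = hyperplane_of n (split_vec n A)"
        | "s H = {x \<in> coord_space {1..n}. 0 \<le> dot n (split_vec n A) x}"
        | "s H = {x \<in> coord_space {1..n}. dot n (split_vec n A) x \<le> 0}"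
        using side'[OF A(1-3)] A(4) by blast
      then show ?thesis
      proof cases
        case 1
        then show ?thesis using walls.cell_zero[OF x F] wH xc by (simp add: hyperplane_of_def)
      next
        case 2
        then show ?thesis using x F wH xc by (simp add: walls.cell_def)
      next
        case 3
        then show ?thesis using walls.cell_nonpos[OF x F] wH xc by simp
      qed
    qed
    moreover have "x \<in> \<tau>" using w(1) xo by (auto simp: C(1) S(2))
    ultimately show "x \<in> C" by (simp add: C(1))
  qed
  then show ?thesis using w wo by blast
qed

lemma subdivision_eq_wall_cells:
  assumes "1 \<le> n"
  shows "subdivision n (orthant n) (partition_hyperplane n ` two_block_partitions n) =
    wall_cell n ` orthant n"
  using wall_cell_in_subdivision[OF _ assms] subdivision_cell_is_wall_cell by blast


section \<open>Cones spanned by complete multipartite graphs\<close>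

lemma cone_of_zero: "(\<lambda>i. 0) \<in> cone_of w I"
  by (auto simp: cone_of_def intro!: exI[of _ "\<lambda>_. 0"])

lemma cone_of_add:
  assumes "x \<in> cone_of w I" "y \<in> cone_of w I"
  shows "(\<lambda>i. x i + y i) \<in> cone_of w I"
proof -
  obtain a where a: "\<forall>\<eta>\<in>I. 0 \<le> a \<eta>" "x = (\<lambda>i. \<Sum>\<eta>\<in>I. a \<eta> * w \<eta> i)"
    using assms(1) by (auto simp: cone_of_def)
  obtain b where b: "\<forall>\<eta>\<in>I. 0 \<le> b \<eta>" "y = (\<lambda>i. \<Sum>\<eta>\<in>I. b \<eta> * w \<eta> i)"
    using assms(2) by (auto simp: cone_of_def)
  have "\<forall>\<eta>\<in>I. 0 \<le> a \<eta> + b \<eta>" using a(1) b(1) by simp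
  moreover have "(\<lambda>i. x i + y i) = (\<lambda>i. \<Sum>\<eta>\<in>I. (a \<eta> + b \<eta>) * w \<eta> i)"
    by (simp add: a(2) b(2) sum.distrib algebra_simps)
  ultimately show ?thesis
    unfolding cone_of_def by (intro CollectI exI[of _ "\<lambda>\<eta>. a \<eta> + b \<eta>"] conjI)
qed

lemma cone_of_generator:
  assumes "finite I" "\<eta> \<in> I" "0 \<le> c"
  shows "(\<lambda>i. c * w \<eta> i) \<in> cone_of w I"
  unfolding cone_of_def
proof (intro CollectI exI conjI ballI ext)
  show "0 \<le> (if \<xi> = \<eta> then c else 0)" for \<xi> using assms(3) by simp
  show "c * w \<eta> i = (\<Sum>\<xi>\<in>I. (if \<xi> = \<eta> then c else 0) * w \<xi> i)" for i
    using assms(1,2) by (simp add: if_distrib[of "\<lambda>x. x * _"] cong: if_cong)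
qed

text \<open>The easy half of cone duality; the inequalities valid on orbit cones are obtained by
  checking them on generators.\<close>

lemma dot_cone_of_nonneg:
  assumes "x \<in> cone_of w I" "\<And>\<eta>. \<eta> \<in> I \<Longrightarrow> 0 \<le> dot n u (w \<eta>)"
  shows "0 \<le> dot n u x"
proof -
  obtain a where a: "\<forall>\<eta>\<in>I. 0 \<le> a \<eta>" "x = (\<lambda>i. \<Sum>\<eta>\<in>I. a \<eta> * w \<eta> i)"
    using assms(1) by (auto simp: cone_of_def)
  have "dot n u x = (\<Sum>\<eta>\<in>I. a \<eta> * dot n u (w \<eta>))"
    unfolding dot_def a(2) sum_distrib_left by (subst sum.swap) (simp add: ac_simps)
  then show ?thesis using a(1) assms(2) by (simp add: sum_nonneg)
qed

text \<open>Edge vectors on all vertices, including 0. The torus weights arise by forgetting the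
  coordinate 0, so the graph arguments can treat all vertices alike.\<close>

abbreviation incidence :: "nat set \<Rightarrow> nat \<Rightarrow> rat" where
  "incidence \<equiv> \<lambda>\<eta> i. of_bool (i \<in> \<eta>)"

lemma sum_incidence_pair:
  assumes "finite Q" "i \<noteq> j"
  shows "(\<Sum>k\<in>Q. e * incidence {i, j} k) = (if i \<in> Q then e else 0) + (if j \<in> Q then e else 0)"
proof -
  have "(\<Sum>k\<in>Q. e * incidence {i, j} k) =
      (\<Sum>k\<in>Q. (if k = i then e else 0) + (if k = j then e else 0))"
    using assms(2) by (intro sum.cong) auto
  then show ?thesis using assms(1) by (simp add: sum.distrib)
qed

text \<open>The termination measure of the two greedy inductions that follow.\<close>

lemma card_support_decrease:
  fixes y y' :: "nat \<Rightarrow> rat"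
  assumes "finite V" "\<And>k. k \<in> V \<Longrightarrow> y k = 0 \<Longrightarrow> y' k = 0" "i \<in> V" "y i \<noteq> 0" "y' i = 0"
  shows "card {k\<in>V. y' k \<noteq> 0} < card {k\<in>V. y k \<noteq> 0}"
  using assms by (intro psubset_card_mono) auto

text \<open>A transportation problem solved greedily: subtracting \<open>min (y i) (y j)\<close>
  times an edge across the two sides exhausts one of its ends and preserves the balance.\<close>

lemma bipartite_in_cone:
  assumes fin: "finite V" "finite I" and P: "P \<subseteq> V"
    and edge: "\<And>i j. i \<in> P \<Longrightarrow> j \<in> V - P \<Longrightarrow> {i, j} \<in> I"
    and y: "\<And>i. 0 \<le> y i" "\<And>i. i \<notin> V \<Longrightarrow> y i = 0" "sum y P = sum y (V - P)"
  shows "y \<in> cone_of incidence I"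
  using y
proof (induction "card {i\<in>V. y i \<noteq> 0}" arbitrary: y rule: less_induct)
  case (less y)
  have finP: "finite P" "finite (V - P)" using fin P finite_subset by auto
  show ?case
  proof (cases "sum y P = 0")
    case True
    then have "\<forall>i\<in>P. y i = 0" "\<forall>i\<in>V - P. y i = 0"
      using less.prems sum_nonneg_eq_0_iff[OF finP(1), of y] sum_nonneg_eq_0_iff[OF finP(2), of y] by auto
    then have "y = (\<lambda>i. 0)" using less.prems(2) P by blast
    then show ?thesis using cone_of_zero[of incidence I] by simp
  next
    case False
    then obtain i where i: "i \<in> P" "y i \<noteq> 0" by (meson sum.neutral)
    from False less.prems(3) obtain j where j: "j \<in> V - P" "y j \<noteq> 0" by (metis sum.neutral)
    define e where "e = min (y i) (y j)"
    define y' where "y' = (\<lambda>k. y k - e * incidence {i, j} k)"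
    have ij: "i \<noteq> j" using i j by auto
    have e: "0 \<le> e" using less.prems(1) by (simp add: e_def)
    have ge: "0 \<le> y' k" for k using less.prems(1)[of k] by (auto simp: y'_def e_def)
    have "card {k\<in>V. y' k \<noteq> 0} < card {k\<in>V. y k \<noteq> 0}"
    proof (cases "y i \<le> y j")
      case True
      show ?thesis
        by (rule card_support_decrease[OF fin(1), of _ _ i])
          (use True i j P in \<open>auto simp: y'_def e_def min_def\<close>)
    next
      case False
      show ?thesis
        by (rule card_support_decrease[OF fin(1), of _ _ j])
          (use False i j P in \<open>auto simp: y'_def e_def min_def\<close>)
    qed
    moreover have "y' k = 0" if "k \<notin> V" for k
      using that less.prems(2) i(1) j(1) P by (auto simp: y'_def)
    moreover have "sum y' P = sum y' (V - P)"
      unfolding y'_def sum_subtractf sum_incidence_pair[OF finP(1) ij] sum_incidence_pair[OF finP(2) ij]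
      using less.prems(3) i j P by auto
    ultimately have "y' \<in> cone_of incidence I" using ge less.hyps by blast
    from cone_of_add[OF this cone_of_generator[OF fin(2) edge[OF i(1) j(1)] e, of incidence]]
    show ?thesis by (simp add: y'_def)
  qed
qed

text \<open>
  Subtract a multiple of an edge until a vertex is used up or a class attains half of the total
  weight; in the latter case the problem has become bipartite.
\<close>

lemma multipartite_in_cone:
  assumes fin: "finite V" "finite I"
    and edge: "\<And>i j. i \<in> V \<Longrightarrow> j \<in> V \<Longrightarrow> c i \<noteq> c j \<Longrightarrow> {i, j} \<in> I"
    and y: "\<And>i. 0 \<le> y i" "\<And>i. i \<notin> V \<Longrightarrow> y i = 0"
      "\<And>k. k \<in> V \<Longrightarrow> 2 * sum y {j\<in>V. c j = c k} \<le> sum y V"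
  shows "y \<in> cone_of incidence I"
  using y
proof (induction "card {i\<in>V. y i \<noteq> 0}" arbitrary: y rule: less_induct)
  case (less y)
  define Q where "Q k = {j\<in>V. c j = c k}" for k
  have finQ: "finite (Q k)" and QV: "Q k \<subseteq> V" for k using fin by (auto simp: Q_def)
  have tight: "z \<in> cone_of incidence I"
    if z: "\<And>i. 0 \<le> z i" "\<And>i. i \<notin> V \<Longrightarrow> z i = 0" "2 * sum z (Q k) = sum z V" for z k
  proof (rule bipartite_in_cone[OF fin QV[of k]])
    show "{i, j} \<in> I" if "i \<in> Q k" "j \<in> V - Q k" for i j
      using that by (intro edge) (auto simp: Q_def)
    show "sum z (Q k) = sum z (V - Q k)"
      using z(3) sum.subset_diff[OF QV fin(1), of z k] by simp
    show "0 \<le> z i" for i by (rule z)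
    show "z i = 0" if "i \<notin> V" for i using that by (rule z)
  qed
  show ?case
  proof (cases "\<exists>i\<in>V. y i \<noteq> 0")
    case False
    then have "y = (\<lambda>i. 0)" using less.prems(2) by blast
    then show ?thesis using cone_of_zero[of incidence I] by simp
  next
    case True
    then obtain i where i: "i \<in> V" "y i \<noteq> 0" by blast
    have "y i \<le> sum y (Q i)"
      using less.prems(1) finQ i(1) by (intro member_le_sum) (auto simp: Q_def)
    then have "0 < sum y (Q i)" using i(2) less.prems(1)[of i] by linarith
    \<comment> \<open>The class of \<open>i\<close> has positive weight but at most half of the
      total, so at least as much weight lies outside it.\<close>
    then have "sum y (V - Q i) \<noteq> 0"
      using less.prems(3)[OF i(1)] sum.subset_diff[OF QV fin(1), of y i] by (simp add: Q_def)
    then obtain j where j: "j \<in> V - Q i" "y j \<noteq> 0" by (meson sum.neutral)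
    have ij: "i \<noteq> j" "c i \<noteq> c j" using i j by (auto simp: Q_def)
    \<comment> \<open>Subtracting \<open>e\<close> times the edge \<open>{i, j}\<close> lowers half
      of the total by \<open>e\<close>, and the classes of \<open>i\<close> and \<open>j\<close> by
      \<open>e\<close> too. Only the remaining classes, those of \<open>K\<close>, lose slack, so
      \<open>M\<close> lists their slacks besides the two vertex weights.\<close>
    define K where "K = {k\<in>V. c k \<noteq> c i \<and> c k \<noteq> c j}"
    define M where "M = insert (y i) (insert (y j) ((\<lambda>k. sum y V / 2 - sum y (Q k)) ` K))"
    define e where "e = Min M"
    have finM: "finite M" "M \<noteq> {}" using fin(1) by (auto simp: M_def K_def)
    have eM: "e \<in> M" unfolding e_def using finM by (rule Min_in)
    have e_le: "e \<le> m" if "m \<in> M" for m unfolding e_def using finM(1) that by (rule Min_le)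
    have "0 \<le> sum y V / 2 - sum y (Q k)" if "k \<in> V" for k
      using less.prems(3)[OF that] by (simp add: Q_def)
    then have "0 \<le> m" if "m \<in> M" for m
      using that less.prems(1) unfolding M_def K_def by blast
    then have e: "0 \<le> e" using eM .
    define y' where "y' = (\<lambda>k. y k - e * incidence {i, j} k)"
    have ge: "0 \<le> y' k" for k
      using less.prems(1)[of k] e_le[of "y i"] e_le[of "y j"] by (auto simp: y'_def M_def)
    have off: "y' k = 0" if "k \<notin> V" for k
      using that less.prems(2) i(1) j(1) by (auto simp: y'_def)
    have sumV: "sum y' V = sum y V - 2 * e"
      unfolding y'_def sum_subtractf sum_incidence_pair[OF fin(1) ij(1)] using i j by simp
    have sumQ: "sum y' (Q k) = sum y (Q k) - (if k \<in> K then 0 else e)" if "k \<in> V" for k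
      unfolding y'_def sum_subtractf sum_incidence_pair[OF finQ ij(1)]
      using that i j ij by (auto simp: K_def Q_def)
    have "2 * sum y' (Q k) \<le> sum y' V" if "k \<in> V" for k
      using less.prems(3)[OF that, folded Q_def] e_le[of "sum y V / 2 - sum y (Q k)"]
      by (auto simp: sumV sumQ[OF that] M_def)
    note bound = this[unfolded Q_def]
    have "y' \<in> cone_of incidence I"
    proof -
      consider "e = y i" | "e = y j" | k where "k \<in> K" "e = sum y V / 2 - sum y (Q k)"
        using eM by (auto simp: M_def)
      then show ?thesis
      proof cases
        case 1
        have "card {k\<in>V. y' k \<noteq> 0} < card {k\<in>V. y k \<noteq> 0}"
          by (rule card_support_decrease[OF fin(1), of _ _ i]) (use 1 i j in \<open>auto simp: y'_def\<close>)
        then show ?thesis using less.hyps ge off bound by blast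
      next
        case 2
        have "card {k\<in>V. y' k \<noteq> 0} < card {k\<in>V. y k \<noteq> 0}"
          by (rule card_support_decrease[OF fin(1), of _ _ j]) (use 2 i j in \<open>auto simp: y'_def\<close>)
        then show ?thesis using less.hyps ge off bound by blast
      next
        case 3
        then have "2 * sum y' (Q k) = sum y' V"
          using sumQ[of k] by (simp add: sumV K_def)
        then show ?thesis using tight ge off by blast
      qed
    qed
    moreover have "{i, j} \<in> I" using i j ij by (intro edge) auto
    ultimately have "(\<lambda>k. y' k + e * incidence {i, j} k) \<in> cone_of incidence I"
      by (intro cone_of_add cone_of_generator fin e)
    then show ?thesis by (simp add: y'_def)
  qed
qed


section \<open>Orbit cones of the Grassmannian\<close>

lemma finite_pairs: "finite (pairs n)"
  by (rule finite_subset[of _ "Pow {0..n}"]) (auto simp: pairs_def)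

lemma doubleton_in_pairs: "{i, j} \<in> pairs n \<longleftrightarrow> i \<noteq> j \<and> i \<le> n \<and> j \<le> n"
proof
  assume "i \<noteq> j \<and> i \<le> n \<and> j \<le> n"
  then show "{i, j} \<in> pairs n"
    unfolding pairs_def by (cases i j rule: linorder_cases) (auto intro: exI[of _ i] exI[of _ j])
qed (auto simp: pairs_def doubleton_eq_iff)

lemma wedge_doubleton:
  assumes "i \<noteq> j" "i \<le> n" "j \<le> n"
  shows "wedge n u v {i, j} \<noteq> 0 \<longleftrightarrow> u i * v j \<noteq> u j * v i"
proof -
  have "{i, j} \<in> pairs n" using assms by (simp add: doubleton_in_pairs)
  then show ?thesis
    by (cases "i < j") (use assms in \<open>auto simp: wedge_def min_def max_def\<close>)
qed

lemma weight_incidence: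
  assumes "\<eta> \<in> pairs n"
  shows "rat_of_int (weight n (torus_act :: (nat \<Rightarrow> 'k::alg_closed_field) \<Rightarrow> _) \<eta> i) =
    (if i = 0 then 0 else incidence \<eta> i)"
proof -
  obtain j k where jk: "\<eta> = {j, k}" "j < k" "k \<le> n" using assms by (auto simp: pairs_def)
  show ?thesis
  proof (cases "j = 0")
    case True
    then show ?thesis using weight_torus_act_0[of k n, where 'k = 'k] jk by (auto simp: unit_vec_def)
  next
    case False
    then show ?thesis using weight_torus_act[of j k n, where 'k = 'k] jk by (auto simp: unit_vec_def)
  qed
qed

text \<open>One formula covers both kinds of weights because \<open>u\<close> vanishes at 0: a pair
  containing 0 contributes only its other entry.\<close>

lemma dot_weight:
  assumes "i \<noteq> j" "i \<le> n" "j \<le> n" "u \<in> coord_space {1..n}"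
  shows "dot n u (\<lambda>k. of_int (weight n (torus_act :: (nat \<Rightarrow> 'k::alg_closed_field) \<Rightarrow> _) {i, j} k)) =
    u i + u j"
proof -
  have "{i, j} \<in> pairs n" using assms by (simp add: doubleton_in_pairs)
  then have "dot n u (\<lambda>k. of_int (weight n (torus_act :: (nat \<Rightarrow> 'k) \<Rightarrow> _) {i, j} k)) =
      (\<Sum>k\<in>{1..n}. (if k = i then u i else 0) + (if k = j then u j else 0))"
    unfolding dot_def by (intro sum.cong) (use assms(1) in \<open>auto simp: weight_incidence\<close>)
  also have "\<dots> = u i + u j"
    using assms by (auto simp: sum.distrib coord_space_def)
  finally show ?thesis .
qed

lemma orbit_cone_coord:
  assumes "x \<in> orbit_cone n (torus_act :: (nat \<Rightarrow> 'k::alg_closed_field) \<Rightarrow> _) I" "I \<subseteq> pairs n"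
  shows "x \<in> coord_space {1..n}"
proof -
  obtain a where "x = (\<lambda>i. \<Sum>\<eta>\<in>I. a \<eta> * of_int (weight n (torus_act :: (nat \<Rightarrow> 'k) \<Rightarrow> _) \<eta> i))"
    using assms(1) by (auto simp: orbit_cone_def cone_of_def)
  moreover have "i \<notin> \<eta>" if "\<eta> \<in> I" "i \<notin> {1..n}" "i \<noteq> 0" for i \<eta>
    using that assms(2) by (fastforce simp: pairs_def)
  then have "rat_of_int (weight n (torus_act :: (nat \<Rightarrow> 'k) \<Rightarrow> _) \<eta> i) = 0"
    if "\<eta> \<in> I" "i \<notin> {1..n}" for i \<eta>
    using that assms(2) weight_incidence[of \<eta> n i] by (auto simp: subset_iff)
  ultimately show ?thesis by (auto simp: coord_space_def intro!: sum.neutral)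
qed

text \<open>A coordinate \<open>y 0\<close> acts as slack, since the weight of \<open>{0, i}\<close> is the projection of \<open>e\<^sub>0 + e\<^sub>i\<close>.\<close>

lemma orbit_coneI:
  assumes "y \<in> cone_of incidence I" "I \<subseteq> pairs n" "x 0 = 0" "\<And>i. i \<noteq> 0 \<Longrightarrow> y i = x i"
  shows "x \<in> orbit_cone n (torus_act :: (nat \<Rightarrow> 'k::alg_closed_field) \<Rightarrow> _) I"
proof -
  obtain a where a: "\<forall>\<eta>\<in>I. 0 \<le> a \<eta>" "y = (\<lambda>i. \<Sum>\<eta>\<in>I. a \<eta> * incidence \<eta> i)"
    using assms(1) unfolding cone_of_def by blast
  have "x i = (\<Sum>\<eta>\<in>I. a \<eta> * of_int (weight n (torus_act :: (nat \<Rightarrow> 'k) \<Rightarrow> _) \<eta> i))" for i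
  proof -
    have "(\<Sum>\<eta>\<in>I. a \<eta> * of_int (weight n (torus_act :: (nat \<Rightarrow> 'k) \<Rightarrow> _) \<eta> i)) =
        (\<Sum>\<eta>\<in>I. a \<eta> * (if i = 0 then 0 else incidence \<eta> i))"
      using assms(2) by (intro sum.cong refl) (auto simp: weight_incidence subset_iff)
    also have "\<dots> = x i"
      using assms(3) assms(4)[of i, symmetric] by (cases "i = 0") (simp_all add: a(2))
    finally show ?thesis by simp
  qed
  then show ?thesis unfolding orbit_cone_def cone_of_def using a(1) by blast
qed

text \<open>The coordinate at \<open>{i, j}\<close> is the minor of columns \<open>i\<close> and
  \<open>j\<close>, nonzero exactly for non-proportional columns. Zero columns are left out of
  \<open>V\<close>: they are proportional to every column and would destroy transitivity.\<close>

lemma orbit_set_multipartite: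
  fixes n :: nat
  assumes "I \<in> orbit_sets n (grassmann_cone n :: (nat set \<Rightarrow> 'k::field) set)"
  obtains V :: "nat set" and c :: "nat \<Rightarrow> nat set" where
    "V \<subseteq> {0..n}" "I = {{i, j} |i j. i \<in> V \<and> j \<in> V \<and> c i \<noteq> c j}"
proof -
  obtain u v :: "nat \<Rightarrow> 'k" where I: "I \<subseteq> pairs n" "\<And>\<eta>. \<eta> \<in> pairs n \<Longrightarrow> wedge n u v \<eta> \<noteq> 0 \<longleftrightarrow> \<eta> \<in> I"
    using assms unfolding orbit_sets_def grassmann_cone_def by blast
  define V where "V = {i. i \<le> n \<and> (u i \<noteq> 0 \<or> v i \<noteq> 0)}"
  \<comment> \<open>The class itself serves as its label, so equality of labels becomes equality of
    classes.\<close>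
  define c where "c i = {j\<in>V. u i * v j = u j * v i}" for i
  have trans: "u i * v k = u k * v i"
    if "j \<in> V" "u i * v j = u j * v i" "u j * v k = u k * v j" for i j k
  proof (cases "v j = 0")
    case True
    then have "u j \<noteq> 0" using that(1) by (simp add: V_def)
    then have "v i = 0" "v k = 0" using that True by auto
    then show ?thesis by simp
  next
    case False
    have "v j * (u i * v k) = (u i * v j) * v k" by (simp add: ac_simps)
    also have "\<dots> = (u j * v k) * v i" by (simp add: that(2) ac_simps)
    also have "\<dots> = v j * (u k * v i)" by (simp add: that(3) ac_simps)
    finally show ?thesis using False by simp
  qed
  have c_eq: "c i = c j \<longleftrightarrow> u i * v j = u j * v i" if "i \<in> V" "j \<in> V" for i j
  proof
    assume "c i = c j"
    moreover have "j \<in> c j" using that by (simp add: c_def)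
    ultimately have "j \<in> c i" by simp
    then show "u i * v j = u j * v i" by (simp add: c_def)
  next
    assume eq: "u i * v j = u j * v i"
    show "c i = c j"
      unfolding c_def using trans[OF that(2) eq] trans[OF that(1) eq[symmetric]] by blast
  qed
  show ?thesis
  proof (rule that)
    show "V \<subseteq> {0..n}" by (auto simp: V_def)
    show "I = {{i, j} |i j. i \<in> V \<and> j \<in> V \<and> c i \<noteq> c j}"
    proof (intro equalityI subsetI)
      fix \<eta> assume \<eta>: "\<eta> \<in> I"
      then obtain i j where ij: "\<eta> = {i, j}" "i < j" "j \<le> n" using I(1) by (auto simp: pairs_def)
      then have "u i * v j \<noteq> u j * v i"
        using I \<eta> wedge_doubleton[of i j n u v] by auto
      moreover from this have V: "i \<in> V" "j \<in> V" using ij by (auto simp: V_def)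
      ultimately have "c i \<noteq> c j" by (simp add: c_eq)
      with V ij(1) show "\<eta> \<in> {{i, j} |i j. i \<in> V \<and> j \<in> V \<and> c i \<noteq> c j}" by blast
    next
      fix \<eta> assume "\<eta> \<in> {{i, j} |i j. i \<in> V \<and> j \<in> V \<and> c i \<noteq> c j}"
      then obtain i j where ij: "\<eta> = {i, j}" "i \<in> V" "j \<in> V" "c i \<noteq> c j" by blast
      then have "i \<noteq> j" "i \<le> n" "j \<le> n" by (auto simp: V_def)
      then show "\<eta> \<in> I"
        using I(2)[of \<eta>] wedge_doubleton[of i j n u v] c_eq[OF ij(2,3)] ij doubleton_in_pairs by auto
    qed
  qed
qed

text \<open>Take columns (1,0) on \<open>P\<close>, (0,1) on \<open>Q\<close> and (0,0) elsewhere;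
  this uses only two distinct directions and works over every field.\<close>

lemma bipartite_orbit_set:
  assumes "P \<subseteq> {0..n}" "Q \<subseteq> {0..n}" "P \<inter> Q = {}"
  shows "{{i, j} |i j. i \<in> P \<and> j \<in> Q} \<in> orbit_sets n (grassmann_cone n :: (nat set \<Rightarrow> 'k::field) set)"
proof -
  let ?I = "{{i, j} |i j. i \<in> P \<and> j \<in> Q}"
  define u :: "nat \<Rightarrow> 'k" where "u = (\<lambda>i. of_bool (i \<in> P))"
  define v :: "nat \<Rightarrow> 'k" where "v = (\<lambda>i. of_bool (i \<in> Q))"
  have sub: "?I \<subseteq> pairs n"
  proof
    fix \<eta> assume "\<eta> \<in> ?I"
    then obtain i j where "\<eta> = {i, j}" "i \<in> P" "j \<in> Q" by blast
    then show "\<eta> \<in> pairs n" using assms by (auto simp: doubleton_in_pairs)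
  qed
  have "wedge n u v \<eta> \<noteq> 0 \<longleftrightarrow> \<eta> \<in> ?I" if \<eta>: "\<eta> \<in> pairs n" for \<eta>
  proof -
    obtain i j where ij: "\<eta> = {i, j}" "i < j" "j \<le> n" using \<eta> by (auto simp: pairs_def)
    have "\<eta> \<in> ?I \<longleftrightarrow> i \<in> P \<and> j \<in> Q \<or> j \<in> P \<and> i \<in> Q"
      unfolding ij(1) by (auto simp: doubleton_eq_iff)
    moreover have "wedge n u v \<eta> \<noteq> 0 \<longleftrightarrow> u i * v j \<noteq> u j * v i"
      unfolding ij(1) by (rule wedge_doubleton) (use ij in auto)
    ultimately show ?thesis using assms(3) by (auto simp: u_def v_def)
  qed
  moreover have "wedge n u v \<in> grassmann_cone n"
  proof -
    have "u \<in> coord_space {0..n}" "v \<in> coord_space {0..n}"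
      using assms by (auto simp: u_def v_def coord_space_def)
    then show ?thesis unfolding grassmann_cone_def by blast
  qed
  ultimately show ?thesis unfolding orbit_sets_def using sub by blast
qed

text \<open>Every inequality that the two greedy lemmas require is, up to the support condition, the
  sign of a wall normal. It holds at \<open>w\<close> because it holds on the generators, and it
  passes to \<open>x\<close> because \<open>x\<close> lies in the cell of \<open>w\<close>.\<close>

lemma wall_cell_subset_orbit_cone:
  fixes n :: nat
  assumes w: "w \<in> orthant n" and I: "I \<in> orbit_sets n (grassmann_cone n :: (nat set \<Rightarrow> 'k::alg_closed_field) set)"
    and wI: "w \<in> orbit_cone n (torus_act :: (nat \<Rightarrow> 'k) \<Rightarrow> _) I"
  shows "wall_cell n w \<subseteq> orbit_cone n (torus_act :: (nat \<Rightarrow> 'k) \<Rightarrow> _) I"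
proof
  fix x assume x: "x \<in> wall_cell n w"
  have Ip: "I \<subseteq> pairs n" using I by (simp add: orbit_sets_def)
  have finI: "finite I" using Ip finite_pairs finite_subset by blast
  obtain V and c :: "nat \<Rightarrow> nat set" where V: "V \<subseteq> {0..n}"
      "I = {{i, j} |i j. i \<in> V \<and> j \<in> V \<and> c i \<noteq> c j}"
    using I by (rule orbit_set_multipartite)
  have finV: "finite V" using V(1) finite_subset by blast
  have edge: "{i, j} \<in> I" if "i \<in> V" "j \<in> V" "c i \<noteq> c j" for i j using that V(2) by blast
  have xo: "x \<in> orthant n" and xw: "\<And>i. w i = 0 \<Longrightarrow> x i = 0"
    and xs: "\<And>A. A \<subseteq> {1..n} \<Longrightarrow> 0 \<le> dot n (split_vec n A) w \<Longrightarrow> 0 \<le> dot n (split_vec n A) x"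
    using x wall_cell_iff[OF w] by auto
  have x0: "\<And>i. 0 \<le> x i" "\<And>i. i \<notin> {1..n} \<Longrightarrow> x i = 0"
    using xo by (auto simp: orthant_iff coord_space_def)
  have wnonneg: "0 \<le> dot n u w"
    if "u \<in> coord_space {1..n}" "\<And>i j. i \<in> V \<Longrightarrow> j \<in> V \<Longrightarrow> c i \<noteq> c j \<Longrightarrow> 0 \<le> u i + u j" for u
    using wI unfolding orbit_cone_def
  proof (rule dot_cone_of_nonneg)
    fix \<eta> assume "\<eta> \<in> I"
    then obtain i j where ij: "\<eta> = {i, j}" "i \<in> V" "j \<in> V" "c i \<noteq> c j" using V(2) by blast
    then have "i \<noteq> j" "i \<le> n" "j \<le> n" using V(1) by auto
    then show "0 \<le> dot n u (\<lambda>k. rat_of_int (weight n (torus_act :: (nat \<Rightarrow> 'k) \<Rightarrow> _) \<eta> k))"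
      using that(1) that(2)[OF ij(2-4)] ij(1) dot_weight[of i j n u, where 'k = 'k] by simp
  qed
  \<comment> \<open>No edge meets a vertex outside \<open>V\<close>, so \<open>w\<close> vanishes
    there, and \<open>x\<close> inherits its zeros.\<close>
  have off: "x i = 0" if "i \<notin> V" for i
  proof (cases "i \<in> {1..n}")
    case True
    have "0 \<le> dot n (\<lambda>j. - unit_vec i j) w"
      by (rule wnonneg) (use True that in \<open>auto simp: coord_space_def unit_vec_def\<close>)
    then have "w i = 0" using True w by (force simp: dot_uminus_left dot_unit_vec orthant_def)
    then show ?thesis by (rule xw)
  qed (use x0 in blast)
  \<comment> \<open>If 0 is a vertex, this is claimed only for its own class: for another class the
    edges to 0 would violate the inequality.\<close>
  have ineq: "sum x (B - {0}) \<le> sum x ({1..n} - B)"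
    if B: "B = {j\<in>V. c j = c k}" "0 \<in> V \<Longrightarrow> c 0 = c k" for k B
  proof -
    let ?A = "{1..n} - B"
    have A: "?A \<subseteq> {1..n}" by blast
    have "0 \<le> dot n (split_vec n ?A) w"
    proof (rule wnonneg[OF split_vec_coord[OF A]])
      fix i j assume ij: "i \<in> V" "j \<in> V" "c i \<noteq> c j"
      then have "i \<le> n" "j \<le> n" using V(1) by auto
      moreover have "\<not> (i \<in> B \<and> j \<in> B)" using B(1) ij by auto
      \<comment> \<open>An edge leaving \<open>B\<close> does not end in 0, since 0 belongs to
        \<open>B\<close> whenever it is a vertex. Hence an entry -1 is always compensated by an
        entry 1.\<close>
      moreover have "j \<noteq> 0" if "i \<in> B" using B ij that by fastforce
      moreover have "i \<noteq> 0" if "j \<in> B" using B ij that by fastforce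
      ultimately show "0 \<le> split_vec n ?A i + split_vec n ?A j"
        by (auto simp: split_vec_def)
    qed
    then have "0 \<le> dot n (split_vec n ?A) x" by (rule xs[OF A])
    moreover have "{1..n} - ?A = B - {0}" using B(1) V(1) by auto
    ultimately show ?thesis using dot_split_vec[OF A, of x] by simp
  qed
  show "x \<in> orbit_cone n (torus_act :: (nat \<Rightarrow> 'k) \<Rightarrow> _) I"
  proof (cases "0 \<in> V")
    case False
    have "x \<in> cone_of incidence I"
      using finV finI edge x0(1) off
    proof (rule multipartite_in_cone)
      fix k assume "k \<in> V"
      let ?B = "{j\<in>V. c j = c k}"
      have "sum x (?B - {0}) \<le> sum x ({1..n} - ?B)" by (rule ineq) (use False in auto)
      moreover have "?B - {0} = ?B" using False by auto
      moreover have "sum x ({1..n} - ?B) = sum x (V - ?B)"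
        by (rule sum.mono_neutral_cong) (use finV off x0 in auto)
      moreover have "sum x V = sum x (V - ?B) + sum x ?B"
        by (rule sum.subset_diff) (use finV in auto)
      ultimately show "2 * sum x ?B \<le> sum x V" by simp
    qed
    then show ?thesis using Ip by (rule orbit_coneI) (use x0 in auto)
  next
    case True
    let ?P = "{j\<in>V. c j = c 0}"
    \<comment> \<open>This weight at vertex 0 makes its class balance all other vertices exactly, so
      the edges leaving that class suffice.\<close>
    define t where "t = sum x ({1..n} - ?P) - sum x (?P - {0})"
    have t: "0 \<le> t" using ineq[of ?P 0] by (simp add: t_def)
    define y where "y = x(0 := t)"
    have "y \<in> cone_of incidence I"
    proof (rule bipartite_in_cone[OF finV finI, of ?P])
      show "{i, j} \<in> I" if "i \<in> ?P" "j \<in> V - ?P" for i j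
        by (rule edge) (use that in auto)
      show "0 \<le> y i" for i using t x0(1) by (simp add: y_def)
      show "y i = 0" if "i \<notin> V" for i using that True off by (auto simp: y_def)
      have "sum y ?P = y 0 + sum y (?P - {0})"
        by (rule sum.remove) (use finV True in auto)
      also have "sum y (?P - {0}) = sum x (?P - {0})"
        by (rule sum.cong) (auto simp: y_def)
      also have "y 0 + \<dots> = sum x ({1..n} - ?P)" by (simp add: y_def t_def)
      also have "\<dots> = sum y (V - ?P)"
        by (rule sum.mono_neutral_cong) (use finV off x0 True in \<open>auto simp: y_def\<close>)
      finally show "sum y ?P = sum y (V - ?P)" .
    qed auto
    then show ?thesis using Ip by (rule orbit_coneI) (use x0 in \<open>auto simp: y_def\<close>)
  qed
qed

text \<open>
  The orbit cone of the two classes \<open>{0} \<union> (A \<inter> supp w)\<close> and \<open>supp w - A\<close> is the face of the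
  orthant generated by \<open>supp w\<close> cut by the half-space of \<open>A\<close>.
\<close>

lemma ex_orbit_cone_halfspace:
  fixes n :: nat
  assumes w: "w \<in> orthant n" and A: "A \<subseteq> {1..n}" "dot n (split_vec n A) w \<le> 0"
  obtains I where "I \<in> orbit_sets n (grassmann_cone n :: (nat set \<Rightarrow> 'k::alg_closed_field) set)"
    "w \<in> orbit_cone n (torus_act :: (nat \<Rightarrow> 'k) \<Rightarrow> _) I"
    "orbit_cone n (torus_act :: (nat \<Rightarrow> 'k) \<Rightarrow> _) I \<subseteq>
      {x \<in> orthant n. (\<forall>i. w i = 0 \<longrightarrow> x i = 0) \<and> dot n (split_vec n A) x \<le> 0}"
proof -
  define S where "S = {i. w i \<noteq> 0}"
  have S: "S \<subseteq> {1..n}" using w by (auto simp: S_def orthant_def coord_space_def)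
  \<comment> \<open>The assumption on \<open>A\<close> says that it is the lighter block at
    \<open>w\<close>, so the free weight of vertex 0 is needed on its side.\<close>
  define P where "P = insert 0 (A \<inter> S)"
  define Q where "Q = S - A"
  define I where "I = {{i, j} |i j. i \<in> P \<and> j \<in> Q}"
  have P0: "P \<subseteq> {0..n}" "Q \<subseteq> {0..n}" "P \<inter> Q = {}" using S by (auto simp: P_def Q_def)
  have orb: "I \<in> orbit_sets n (grassmann_cone n :: (nat set \<Rightarrow> 'k) set)"
    unfolding I_def by (rule bipartite_orbit_set[OF P0])
  then have Ip: "I \<subseteq> pairs n" by (simp add: orbit_sets_def)
  have fin: "finite I" "finite P" "finite Q" "finite S"
    using Ip finite_pairs P0 S finite_subset by blast+
  have w0: "\<And>i. 0 \<le> w i" "w 0 = 0"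
    using w by (auto simp: orthant_iff coord_space_def)
  \<comment> \<open>The amount by which the complement of \<open>A\<close> outweighs
    \<open>A\<close>, carried by vertex 0 to balance the two classes.\<close>
  define t where "t = - dot n (split_vec n A) w"
  define y where "y = w(0 := t)"
  have "y \<in> cone_of incidence I"
  proof (rule bipartite_in_cone[of "P \<union> Q" I P])
    show "{i, j} \<in> I" if "i \<in> P" "j \<in> P \<union> Q - P" for i j using that by (auto simp: I_def)
    show "0 \<le> y i" for i using w0 A(2) by (simp add: y_def t_def)
    show "y i = 0" if "i \<notin> P \<union> Q" for i using that by (auto simp: y_def P_def Q_def S_def)
    have "sum y P = y 0 + sum y (P - {0})"
      by (rule sum.remove) (use fin in \<open>auto simp: P_def\<close>)
    also have "sum y (P - {0}) = sum w A"
      by (rule sum.mono_neutral_cong)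
        (use fin A finite_subset w0 in \<open>auto simp: y_def P_def S_def\<close>)
    also have "y 0 + \<dots> = sum w ({1..n} - A)" by (simp add: y_def t_def dot_split_vec[OF A(1)])
    also have "\<dots> = sum y (P \<union> Q - P)"
      by (rule sum.mono_neutral_cong) (use fin S in \<open>auto simp: y_def P_def Q_def S_def\<close>)
    finally show "sum y P = sum y (P \<union> Q - P)" .
  qed (use fin in auto)
  then have win: "w \<in> orbit_cone n (torus_act :: (nat \<Rightarrow> 'k) \<Rightarrow> _) I"
    using Ip by (rule orbit_coneI) (use w0 in \<open>auto simp: y_def\<close>)
  have "x \<in> {x \<in> orthant n. (\<forall>i. w i = 0 \<longrightarrow> x i = 0) \<and> dot n (split_vec n A) x \<le> 0}"
    if x: "x \<in> orbit_cone n (torus_act :: (nat \<Rightarrow> 'k) \<Rightarrow> _) I" for x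
  proof -
    have xc: "x \<in> coord_space {1..n}" using x Ip by (rule orbit_cone_coord)
    have nonneg: "0 \<le> dot n u x"
      if "u \<in> coord_space {1..n}" "\<And>i j. i \<in> P \<Longrightarrow> j \<in> Q \<Longrightarrow> 0 \<le> u i + u j" for u
      using x unfolding orbit_cone_def
    proof (rule dot_cone_of_nonneg)
      fix \<eta> assume "\<eta> \<in> I"
      then obtain i j where ij: "\<eta> = {i, j}" "i \<in> P" "j \<in> Q" unfolding I_def by blast
      then have "i \<noteq> j" "i \<le> n" "j \<le> n" using P0 by auto
      then show "0 \<le> dot n u (\<lambda>k. rat_of_int (weight n (torus_act :: (nat \<Rightarrow> 'k) \<Rightarrow> _) \<eta> k))"
        using that(1) that(2)[OF ij(2,3)] ij(1) dot_weight[of i j n u, where 'k = 'k] by simp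
    qed
    have pos: "0 \<le> x i" if "i \<in> {1..n}" for i
      using nonneg[of "unit_vec i"] that dot_unit_vec[OF that, of x]
      by (auto simp: coord_space_def unit_vec_def)
    have "x i = 0" if wi: "w i = 0" for i
    proof (cases "i \<in> {1..n}")
      case True
      have "0 \<le> dot n (\<lambda>j. - unit_vec i j) x"
      proof (rule nonneg)
        show "(\<lambda>j. - unit_vec i j :: rat) \<in> coord_space {1..n}"
          using True by (auto simp: coord_space_def unit_vec_def)
        fix j k assume "j \<in> P" "k \<in> Q"
        then have "j \<noteq> i" "k \<noteq> i" using wi True by (auto simp: P_def Q_def S_def)
        then show "0 \<le> - unit_vec i j + - (unit_vec i k :: rat)" by (simp add: unit_vec_def)
      qed
      then show ?thesis using pos[OF True] True by (simp add: dot_uminus_left dot_unit_vec)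
    next
      case False
      then show ?thesis using xc by (simp add: coord_space_def)
    qed
    moreover have "0 \<le> dot n (\<lambda>i. - split_vec n A i) x"
    proof (rule nonneg)
      show "(\<lambda>i. - split_vec n A i) \<in> coord_space {1..n}"
        by (rule coord_space_uminus[OF split_vec_coord[OF A(1)]])
      fix i j assume "i \<in> P" "j \<in> Q"
      then show "0 \<le> - split_vec n A i + - split_vec n A j"
        using S by (auto simp: split_vec_def P_def Q_def)
    qed
    ultimately show ?thesis using xc pos by (simp add: orthant_def dot_uminus_left)
  qed
  then show ?thesis using that[OF orb win] by blast
qed

text \<open>Each orbit cone through \<open>w\<close> contains the cell of \<open>w\<close>. In the
  other direction no single orbit cone has to equal the cell: each half-space condition is supplied
  by its own orbit cone, and the intersection collects them.\<close>

lemma GIT_cone_grassmann: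
  fixes n :: nat
  assumes w: "w \<in> orthant n"
  shows "GIT_cone n torus_act (grassmann_cone n :: (nat set \<Rightarrow> 'k::alg_closed_field) set) w = wall_cell n w"
proof
  show "wall_cell n w \<subseteq> GIT_cone n torus_act (grassmann_cone n :: (nat set \<Rightarrow> 'k) set) w"
    unfolding GIT_cone_def using wall_cell_subset_orbit_cone[OF w] by blast
next
  show "GIT_cone n torus_act (grassmann_cone n :: (nat set \<Rightarrow> 'k) set) w \<subseteq> wall_cell n w"
  proof
    fix x assume x: "x \<in> GIT_cone n torus_act (grassmann_cone n :: (nat set \<Rightarrow> 'k) set) w"
    have half: "x \<in> orthant n \<and> (\<forall>i. w i = 0 \<longrightarrow> x i = 0) \<and> dot n (split_vec n A) x \<le> 0"
      if A: "A \<subseteq> {1..n}" "dot n (split_vec n A) w \<le> 0" for A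
    proof -
      obtain I where I: "I \<in> orbit_sets n (grassmann_cone n :: (nat set \<Rightarrow> 'k) set)"
        "w \<in> orbit_cone n (torus_act :: (nat \<Rightarrow> 'k) \<Rightarrow> _) I"
        "orbit_cone n (torus_act :: (nat \<Rightarrow> 'k) \<Rightarrow> _) I \<subseteq>
          {x \<in> orthant n. (\<forall>i. w i = 0 \<longrightarrow> x i = 0) \<and> dot n (split_vec n A) x \<le> 0}"
        using ex_orbit_cone_halfspace[OF w A, where 'k = 'k] by blast
      have "x \<in> orbit_cone n (torus_act :: (nat \<Rightarrow> 'k) \<Rightarrow> _) I"
        using x I(1,2) unfolding GIT_cone_def by blast
      then show ?thesis using I(3) by blast
    qed
    \<comment> \<open>The available orbit cones bound \<open>split_vec\<close> from above; a lower
      bound for \<open>A\<close> is the upper bound for its complement.\<close>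
    have "0 \<le> dot n (split_vec n A) x" if A: "A \<subseteq> {1..n}" "0 \<le> dot n (split_vec n A) w" for A
    proof -
      have "dot n (split_vec n ({1..n} - A)) y = - dot n (split_vec n A) y" for y
        unfolding split_vec_compl[OF A(1)] by (rule dot_uminus_left)
      then show ?thesis using half[of "{1..n} - A"] A(2) by (simp only: Diff_subset neg_le_0_iff_le)
    qed
    \<comment> \<open>The empty block satisfies the hypothesis of \<open>half\<close> at every
      \<open>w\<close> in the orthant and so supplies the orthant and support conditions.\<close>
    then show "x \<in> wall_cell n w"
      using half[of "{}"] dot_split_vec_trivial[OF w] wall_cell_iff[OF w] by simp
  qed
qed

theorem theorem3p3:
  fixes n :: nat and Y :: "(nat set \<Rightarrow> 'k::alg_closed_field) set"
  assumes "n \<ge> 2" and "Y = grassmann_cone n"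
  shows "is_fan n (GIT_fan n torus_act Y) \<and>
    \<Union>(GIT_fan n torus_act Y) = orthant n \<and>
    GIT_fan n torus_act Y =
      subdivision n (orthant n) (partition_hyperplane n ` two_block_partitions n)"
proof -
  have fan: "GIT_fan n torus_act Y = wall_cell n ` orthant n"
    unfolding GIT_fan_def assms(2) using GIT_cone_grassmann[where 'k = 'k] by blast
  have sub: "wall_cell n w \<subseteq> orthant n" if "w \<in> orthant n" for w
    using wall_cell_iff[OF that] by blast
  have "w \<in> wall_cell n w" if "w \<in> orthant n" for w
    using that by (simp add: walls.cell_self orthant_def)
  then have "\<Union>(wall_cell n ` orthant n) = orthant n" using sub by blast
  then show ?thesis
    unfolding fan using walls.is_fan_cells[OF sub pointed_orthant] subdivision_eq_wall_cells assms(1)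
    by simp
qed

end
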